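(* There exists an absolute constant $c>0$ such that the following holds. Let $n \in \mathbb{N}$ and let $A \subset S_n$ be a conjugation-invariant set of permutations with $0 < |A| \leq n!/2$, and let $p = |A|/n!$. Then \[ |\partial A| \ge c \cdot \frac{\log_2 \left( \tfrac{1}{p} \right)}{\log_2 \log_2 \left( \tfrac{2}{p} \right)}\cdot n \cdot |A|. \]
   Context: $S_n$ is the symmetric group on $[n]=\{1,\dots,n\}$. $T_n$ is the transposition graph: the Cayley graph on $S_n$ generated by all transpositions, i.e. $\sigma,\pi \in S_n$ are adjacent iff $\sigma\pi^{-1}$ is a transposition. For $A \subset S_n$, $\partial A$ denotes the edge-boundary of $A$ in $T_n$, i.e. the set of edges of $T_n$ with exactly one endpoint in $A$. A set $A \subset S_n$ is conjugation-invariant if $\pi\sigma\pi^{-1} \in A$ for all $\sigma \in A$, $\pi \in S_n$ (equivalently, $A$ is a union of conjugacy classes). *)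

theory Defs
  imports Complex_Main "HOL-Combinatorics.Permutations"
begin

text \<open>
  Elements of the symmetric group on \<open>[n]\<close> are total functions on \<open>nat\<close> that
  permute \<open>{1..n}\<close> and fix every other number.
\<close>

definition Sym :: "nat \<Rightarrow> (nat \<Rightarrow> nat) set" where
  "Sym n = {\<sigma>. \<sigma> permutes {1..n}}"

definition is_transposition :: "nat \<Rightarrow> (nat \<Rightarrow> nat) \<Rightarrow> bool" where
  "is_transposition n \<tau> \<longleftrightarrow>
     (\<exists>a\<in>{1..n}. \<exists>b\<in>{1..n}. a \<noteq> b \<and> \<tau> = Transposition.transpose a b)"

text \<open>
  The transposition graph is undirected, so an edge is the unordered pair (a
  two-element set) of its endpoints and is counted once.
\<close>

definition transposition_graph_edges :: "nat \<Rightarrow> (nat \<Rightarrow> nat) set set" where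
  "transposition_graph_edges n =
     {{\<sigma>, \<pi>} | \<sigma> \<pi>. \<sigma> \<in> Sym n \<and> \<pi> \<in> Sym n \<and> is_transposition n (\<sigma> \<circ> inv \<pi>)}"

definition edge_boundary :: "nat \<Rightarrow> (nat \<Rightarrow> nat) set \<Rightarrow> (nat \<Rightarrow> nat) set set" where
  "edge_boundary n A = {e \<in> transposition_graph_edges n. card (e \<inter> A) = 1}"

definition conjugation_invariant :: "nat \<Rightarrow> (nat \<Rightarrow> nat) set \<Rightarrow> bool" where
  "conjugation_invariant n A \<longleftrightarrow> (\<forall>\<sigma>\<in>A. \<forall>\<pi>\<in>Sym n. \<pi> \<circ> \<sigma> \<circ> inv \<pi> \<in> A)"

end

(*
  Leave the cycle through a root out of the cycle type. The remaining counts y = (y_j) then have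
  weight prod_j 1 / (j^y_j y_j!), a product measure truncated to sum_j j y_j < n. A transposition
  (1 k) that merges the root cycle with a j-cycle turns the type y + e_j into y, so for a
  conjugation-invariant A the edge boundary dominates the boundary of its set B of types in the
  graph with edges {y, y + e_j}.

  By subadditivity of entropy, log (1/p) is at most the sum over j of the mean of -log of the
  measure of the section of B in direction j, up to a loss from the truncation. A section
  that starts at m >= 1 costs about m log (j m), while its boundary has weight about j m relative to
  its own measure; the ratio is O(1 + log m), and m > log (1/p) is too rare to matter. This yields
  the denominator log log (2/p). The loss is the mean of log (n / root cycle length), which is at most
  (2/3) log (1/p) + O(1) because the types of A do not depend on the choice of the root.

  If p is bounded below, write a permutation as a product of at most n transpositions: all
  transpositions take equally many elements of A out of A, hence each takes at least |A| / 2n.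
*)
theory Submission
  imports Defs "HOL-Combinatorics.Orbits"
begin

section \<open>Orbits after multiplication by a transposition\<close>

text \<open>The lengths of all cycles sum to n, so if every cycle is counted, a count is determined
  by the others, one-dimensional sections are single points, and merging two cycles can change three
  counts at once. Dropping the root cycle turns the equation into an inequality, and a merger with
  the root changes one count only. The inequality has a price. A section in direction j can rely on
  the mass 1 + 1/j of the values 0 and 1 only for j below the root length l, and the product of
  these factors over j < l is l, whereas all types together have mass n. The deficit ln (n / l) has
  mean about ln (1/p) on the set of types with l at most pn, which would use up the whole entropy.
  That set singles out the root, however: a second random point usually lies on a much longer cycle.
  For a set that does not depend on the choice of the root, short root cycles force short cycles at
  a second point too, and this is rarer.\<close>

lemma orbit_enum:
  assumes "permutation f"
  shows "(f ^^ card (orbit f x)) x = x"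
    and "inj_on (\<lambda>i. (f ^^ i) x) {0..<card (orbit f x)}"
    and "orbit f x = (\<lambda>i. (f ^^ i) x) ` {0..<card (orbit f x)}"
    and "0 < card (orbit f x)"
proof -
  have self: "x \<in> orbit f x"
    using assms by (rule permutation_self_in_orbit)
  define d where "d = funpow_dist1 f x x"
  have im: "orbit f x = (\<lambda>i. (f ^^ i) x) ` {0..<d}"
    unfolding d_def using orbit_conv_funpow_dist1[OF self] .
  have inj: "inj_on (\<lambda>i. (f ^^ i) x) {0..<d}"
    unfolding d_def using inj_on_funpow_dist1[OF self] .
  have card: "card (orbit f x) = d"
    unfolding im using card_image[OF inj] by simp
  show "(f ^^ card (orbit f x)) x = x"
    unfolding card using funpow_dist1_prop[OF self] by (simp add: d_def)
  show "inj_on (\<lambda>i. (f ^^ i) x) {0..<card (orbit f x)}"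
    unfolding card by (rule inj)
  show "orbit f x = (\<lambda>i. (f ^^ i) x) ` {0..<card (orbit f x)}"
    unfolding card by (rule im)
  show "0 < card (orbit f x)" unfolding card d_def by simp
qed

lemma orbit_eq_iff:
  assumes "permutation f"
  shows "orbit f x = orbit f y \<longleftrightarrow> x \<in> orbit f y"
  using assms by (metis cyclic_on_orbit' orbit_cyclic_eq3 permutation_self_in_orbit)

text \<open>Here \<open>g\<close> joins the \<open>f\<close>-path of \<open>k\<close> by a jump from
  \<open>r\<close>. The starting points \<open>r\<close> and \<open>k\<close> may differ, so the
  claim begins at \<open>i = 1\<close>.\<close>

lemma funpow_agree:
  assumes start: "g r = f k"
    and agree: "\<And>i. 1 \<le> i \<Longrightarrow> i < j \<Longrightarrow> g ((f ^^ i) k) = f ((f ^^ i) k)"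
    and "1 \<le> i" "i \<le> j"
  shows "(g ^^ i) r = (f ^^ i) k"
  using assms(3,4)
proof (induction i)
  case (Suc i)
  show ?case
  proof (cases "i = 0")
    case True
    then show ?thesis using start by simp
  next
    case False
    then show ?thesis using Suc agree[of i] by simp
  qed
qed simp

definition orbits_off :: "'a set \<Rightarrow> 'a \<Rightarrow> ('a \<Rightarrow> 'a) \<Rightarrow> 'a set set" where
  "orbits_off S r \<sigma> = orbit \<sigma> ` S - {orbit \<sigma> r}"

definition cycle_counts :: "'a set \<Rightarrow> 'a \<Rightarrow> ('a \<Rightarrow> 'a) \<Rightarrow> nat \<Rightarrow> nat" where
  "cycle_counts S r \<sigma> j = card {C \<in> orbits_off S r \<sigma>. card C = j}"

lemma permutes_permutation: "finite S \<Longrightarrow> \<sigma> permutes S \<Longrightarrow> permutation \<sigma>"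
  by (auto simp: permutation_permutes)

lemma merge_permutes:
  assumes "\<sigma> permutes S" "r \<in> S" "k \<in> S"
  shows "(\<sigma> \<circ> transpose r k) permutes S"
  using assms by (intro permutes_compose permutes_swap_id) auto

text \<open>The product sends \<open>r\<close> where \<sigma> sends \<open>k\<close>, so the path
  from \<open>r\<close> runs once around the cycle of \<open>k\<close> and is at \<open>k\<close>
  itself after exactly \<open>card (orbit \<sigma> k)\<close> steps. This is how
  \<open>merge_bij\<close> recovers \<open>k\<close> from a length.\<close>

lemma merge_funpow:
  assumes fin: "finite S" and \<sigma>: "\<sigma> permutes S" and k: "k \<notin> orbit \<sigma> r"
    and i: "1 \<le> i" "i \<le> card (orbit \<sigma> k)"
  shows "((\<sigma> \<circ> transpose r k) ^^ i) r = (\<sigma> ^^ i) k"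
proof (rule funpow_agree[OF _ _ i])
  have pm: "permutation \<sigma>" using permutes_permutation[OF fin \<sigma>] .
  fix i assume i: "1 \<le> i" "i < card (orbit \<sigma> k)"
  have "(\<sigma> ^^ i) k \<noteq> k"
    using orbit_enum(2)[OF pm, of k] i by (auto dest!: inj_onD[where x=i and y=0])
  moreover have "(\<sigma> ^^ i) k \<noteq> r"
    using k pm by (metis funpow_in_orbit orbit_eq_iff permutation_self_in_orbit)
  ultimately show "(\<sigma> \<circ> transpose r k) ((\<sigma> ^^ i) k) = \<sigma> ((\<sigma> ^^ i) k)"
    by simp
qed simp

lemma merge_orbit_other:
  assumes fin: "finite S" and \<sigma>: "\<sigma> permutes S" and x: "x \<notin> orbit \<sigma> r" "x \<notin> orbit \<sigma> k"
  shows "orbit (\<sigma> \<circ> transpose r k) x = orbit \<sigma> x"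
proof (rule orbit_cong)
  have pm: "permutation \<sigma>" using permutes_permutation[OF fin \<sigma>] .
  show "x \<in> orbit \<sigma> x" using pm by (rule permutation_self_in_orbit)
  fix s assume "s \<in> orbit \<sigma> x"
  then have "s \<noteq> r" "s \<noteq> k"
    using x pm by (metis orbit_eq_iff permutation_self_in_orbit)+
  then show "(\<sigma> \<circ> transpose r k) s = \<sigma> s" by simp
qed

lemma merge_orbit_root:
  assumes fin: "finite S" and \<sigma>: "\<sigma> permutes S" and S: "r \<in> S" "k \<in> S" and k: "k \<notin> orbit \<sigma> r"
  shows "orbit (\<sigma> \<circ> transpose r k) r = orbit \<sigma> r \<union> orbit \<sigma> k"
proof -
  let ?\<sigma> = "\<sigma> \<circ> transpose r k"
  have pm: "permutation \<sigma>" using permutes_permutation[OF fin \<sigma>] .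
  have pm': "permutation ?\<sigma>"
    using permutes_permutation[OF fin merge_permutes[OF \<sigma> S]] .
  have r: "r \<notin> orbit \<sigma> k" using k pm by (metis orbit_eq_iff permutation_self_in_orbit)
  \<comment> \<open>Stated for arbitrary \<open>r\<close> and \<open>k\<close>, since it is applied
    in both directions; the transposition is symmetric in its two points.\<close>
  have sub: "orbit \<tau> k \<subseteq> orbit (\<tau> \<circ> transpose r k) r"
    if \<tau>: "\<tau> permutes S" "k \<notin> orbit \<tau> r" for \<tau> r k
  proof
    have pm: "permutation \<tau>" using permutes_permutation[OF fin \<tau>(1)] .
    fix x assume "x \<in> orbit \<tau> k"
    then obtain i where i: "x = (\<tau> ^^ i) k" "i < card (orbit \<tau> k)"
      by (subst (asm) orbit_enum(3)[OF pm]) auto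
    \<comment> \<open>The point \<open>k\<close> has index 0 on its own cycle, but is reached from
      \<open>r\<close> only after a full period.\<close>
    define i' where "i' = (if i = 0 then card (orbit \<tau> k) else i)"
    have "x = (\<tau> ^^ i') k" "1 \<le> i'" "i' \<le> card (orbit \<tau> k)"
      using i orbit_enum(1,4)[OF pm, of k] by (auto simp: i'_def)
    then show "x \<in> orbit (\<tau> \<circ> transpose r k) r"
      using merge_funpow[OF fin \<tau>(1,2), of i'] by (auto simp: orbit_altdef intro!: exI[of _ i'])
  qed
  have 1: "orbit \<sigma> k \<subseteq> orbit ?\<sigma> r" by (rule sub[OF \<sigma> k])
  have 2: "orbit \<sigma> r \<subseteq> orbit ?\<sigma> k"
    using sub[OF \<sigma> r] by (simp add: transpose_commute)
  have "k \<in> orbit ?\<sigma> r" using 1 pm by (blast intro: permutation_self_in_orbit)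
  then have 3: "orbit ?\<sigma> k = orbit ?\<sigma> r" using pm' by (simp add: orbit_eq_iff)
  have "orbit ?\<sigma> r \<subseteq> orbit \<sigma> r \<union> orbit \<sigma> k"
  proof
    fix x assume "x \<in> orbit ?\<sigma> r"
    then show "x \<in> orbit \<sigma> r \<union> orbit \<sigma> k"
    proof induction
      case (step y)
      then show ?case by (cases "y = r \<or> y = k") (auto intro: orbit.intros)
    qed (auto intro: orbit.intros)
  qed
  with 1 2 3 show ?thesis by auto
qed

text \<open>The inverse of a merger: if \<open>k\<close> lies \<open>j\<close> steps after
  \<open>r\<close>, the product sends \<open>k\<close> to \<sigma> r, and the arc \<sigma> r, ...,
  \<sigma>^j r = k closes up to a cycle of length \<open>j\<close> without \<open>r\<close>.\<close>

lemma split_orbit: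
  assumes fin: "finite S" and \<sigma>: "\<sigma> permutes S" and j: "1 \<le> j" "j < card (orbit \<sigma> r)"
  defines "k \<equiv> (\<sigma> ^^ j) r"
  shows "k \<notin> orbit (\<sigma> \<circ> transpose r k) r" "card (orbit (\<sigma> \<circ> transpose r k) k) = j" "k \<in> orbit \<sigma> r"
proof -
  let ?\<sigma> = "\<sigma> \<circ> transpose r k"
  have pm: "permutation \<sigma>" using permutes_permutation[OF fin \<sigma>] .
  note inj = inj_onD[OF orbit_enum(2)[OF pm, of r]]
  show ko: "k \<in> orbit \<sigma> r" unfolding k_def using j by (auto simp: orbit_altdef)
  have eq: "(?\<sigma> ^^ i) k = (\<sigma> ^^ i) r" if "1 \<le> i" "i \<le> j" for i
  proof (rule funpow_agree[OF _ _ that])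
    fix i assume "1 \<le> i" "i < j"
    then have "(\<sigma> ^^ i) r \<noteq> r" "(\<sigma> ^^ i) r \<noteq> k"
      using inj[of i 0] inj[of i j] j by (auto simp: k_def)
    then show "?\<sigma> ((\<sigma> ^^ i) r) = \<sigma> ((\<sigma> ^^ i) r)" by simp
  qed simp
  have "(?\<sigma> ^^ j) k = k" using eq[of j] j by (simp add: k_def)
  then have o: "orbit ?\<sigma> k = {(?\<sigma> ^^ m) k | m. m < j}"
    using j by (intro orbit_altdef_bounded) auto
  also have "\<dots> = (\<lambda>i. (\<sigma> ^^ i) r) ` {1..j}"
  proof (intro equalityI subsetI)
    fix x assume "x \<in> {(?\<sigma> ^^ m) k | m. m < j}"
    then obtain m where m: "x = (?\<sigma> ^^ m) k" "m < j" by blast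
    show "x \<in> (\<lambda>i. (\<sigma> ^^ i) r) ` {1..j}"
    proof (cases "m = 0")
      case True
      then show ?thesis using m j by (auto simp: k_def)
    next
      case False
      then show ?thesis using m eq[of m] by auto
    qed
  next
    fix x assume "x \<in> (\<lambda>i. (\<sigma> ^^ i) r) ` {1..j}"
    then obtain i where i: "x = (\<sigma> ^^ i) r" "1 \<le> i" "i \<le> j" by auto
    show "x \<in> {(?\<sigma> ^^ m) k | m. m < j}"
    proof (cases "i = j")
      case True
      then have "x = (?\<sigma> ^^ 0) k" using i by (simp add: k_def)
      then show ?thesis using j by (intro CollectI exI[of _ 0]) auto
    next
      case False
      then show ?thesis using i eq[of i] by (intro CollectI exI[of _ i]) auto
    qed
  qed
  finally have o': "orbit ?\<sigma> k = (\<lambda>i. (\<sigma> ^^ i) r) ` {1..j}" .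
  have "inj_on (\<lambda>i. (\<sigma> ^^ i) r) {1..j}"
    using j by (intro inj_on_subset[OF orbit_enum(2)[OF pm]]) auto
  then show "card (orbit ?\<sigma> k) = j" unfolding o' by (simp add: card_image)
  have "r \<notin> orbit ?\<sigma> k"
  proof
    assume "r \<in> orbit ?\<sigma> k"
    then obtain i where "r = (\<sigma> ^^ i) r" "1 \<le> i" "i \<le> j" unfolding o' by auto
    then show False using inj[of i 0] j by auto
  qed
  moreover have "permutation ?\<sigma>"
    by (intro permutation_compose pm permutation_swap_id)
  ultimately show "k \<notin> orbit ?\<sigma> r"
    by (metis orbit_eq_iff permutation_self_in_orbit)
qed


section \<open>Rooted cycle counts under a merger\<close>

lemma orbits_off_merge:
  assumes fin: "finite S" and \<sigma>: "\<sigma> permutes S" and S: "r \<in> S" "k \<in> S" and k: "k \<notin> orbit \<sigma> r"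
  shows "orbits_off S r (\<sigma> \<circ> transpose r k) = orbits_off S r \<sigma> - {orbit \<sigma> k}"
    and "orbit \<sigma> k \<in> orbits_off S r \<sigma>"
proof -
  let ?\<sigma> = "\<sigma> \<circ> transpose r k"
  have pm: "permutation \<sigma>" using permutes_permutation[OF fin \<sigma>] .
  have pm': "permutation ?\<sigma>"
    using permutes_permutation[OF fin merge_permutes[OF \<sigma> S]] .
  note root = merge_orbit_root[OF fin \<sigma> S k]
  have out: "orbit ?\<sigma> x = (if x \<in> orbit \<sigma> r \<union> orbit \<sigma> k then orbit ?\<sigma> r else orbit \<sigma> x)" for x
  proof (cases "x \<in> orbit \<sigma> r \<union> orbit \<sigma> k")
    case True
    then have "x \<in> orbit ?\<sigma> r" unfolding root .
    with True show ?thesis using orbit_eq_iff[OF pm', of x r] by auto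
  next
    case False
    then show ?thesis using merge_orbit_other[OF fin \<sigma>, of x r k] by auto
  qed
  have self: "x \<in> orbit \<sigma> x" "x \<in> orbit ?\<sigma> x" for x
    using pm pm' by (auto intro: permutation_self_in_orbit)
  show "orbits_off S r ?\<sigma> = orbits_off S r \<sigma> - {orbit \<sigma> k}"
  proof (intro equalityI subsetI)
    fix C assume "C \<in> orbits_off S r ?\<sigma>"
    then obtain x where x: "x \<in> S" "C = orbit ?\<sigma> x" "C \<noteq> orbit ?\<sigma> r"
      by (auto simp: orbits_off_def)
    have "x \<notin> orbit \<sigma> r \<union> orbit \<sigma> k"
    proof
      assume "x \<in> orbit \<sigma> r \<union> orbit \<sigma> k"
      then have "orbit ?\<sigma> x = orbit ?\<sigma> r" using out[of x] by (simp only: if_True)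
      then show False using x(2,3) by simp
    qed
    then have "C = orbit \<sigma> x" "C \<noteq> orbit \<sigma> r" "C \<noteq> orbit \<sigma> k"
      using out[of x] x(2) orbit_eq_iff[OF pm, of x r] orbit_eq_iff[OF pm, of x k] by simp_all
    then show "C \<in> orbits_off S r \<sigma> - {orbit \<sigma> k}" using x by (auto simp: orbits_off_def)
  next
    fix C assume "C \<in> orbits_off S r \<sigma> - {orbit \<sigma> k}"
    then obtain x where x: "x \<in> S" "C = orbit \<sigma> x" "C \<noteq> orbit \<sigma> r" "C \<noteq> orbit \<sigma> k"
      by (auto simp: orbits_off_def)
    then have nx: "x \<notin> orbit \<sigma> r \<union> orbit \<sigma> k" using pm by (simp add: orbit_eq_iff)
    then have "C = orbit ?\<sigma> x" using out[of x] x by simp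
    moreover have "x \<notin> orbit ?\<sigma> r" using nx root by simp
    ultimately show "C \<in> orbits_off S r ?\<sigma>"
      using x(1) self(2)[of x] by (auto simp: orbits_off_def)
  qed
  show "orbit \<sigma> k \<in> orbits_off S r \<sigma>"
    using S(2) k self(1)[of k] by (auto simp: orbits_off_def)
qed

lemma finite_orbits_off: "finite S \<Longrightarrow> finite (orbits_off S r \<sigma>)"
  by (simp add: orbits_off_def)

lemma cycle_counts_merge:
  assumes "finite S" "\<sigma> permutes S" "r \<in> S" "k \<in> S" "k \<notin> orbit \<sigma> r"
  defines "\<sigma>' \<equiv> \<sigma> \<circ> transpose r k"
  defines "j \<equiv> card (orbit \<sigma> k)"
  shows "cycle_counts S r \<sigma> = (cycle_counts S r \<sigma>')(j := Suc (cycle_counts S r \<sigma>' j))"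
proof
  fix i
  note off = orbits_off_merge[OF assms(1-5)]
  have eq: "{C \<in> orbits_off S r \<sigma>. card C = i} =
      {C \<in> orbits_off S r \<sigma>'. card C = i} \<union> (if i = j then {orbit \<sigma> k} else {})"
    unfolding \<sigma>'_def off(1) j_def using off(2) by auto
  have "finite {C \<in> orbits_off S r \<sigma>'. card C = i}"
    using finite_orbits_off[OF assms(1)] by simp
  moreover have "orbit \<sigma> k \<notin> orbits_off S r \<sigma>'" unfolding \<sigma>'_def off(1) by simp
  ultimately show "cycle_counts S r \<sigma> i = ((cycle_counts S r \<sigma>')(j := Suc (cycle_counts S r \<sigma>' j))) i"
    unfolding cycle_counts_def eq by auto
qed

text \<open>A point \<open>k\<close> off the root cycle is traded for the length of its cycle. After
  the merger this length is the position of \<open>k\<close> on the root cycle, so nothing is lost.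
  Every permutation thus arises once for each \<open>j\<close> below its root length, which makes
  all later double counts exact.\<close>

lemma merge_bij:
  assumes fin: "finite S" and r: "r \<in> S"
  shows "bij_betw (\<lambda>(\<sigma>, k). (\<sigma> \<circ> transpose r k, card (orbit \<sigma> k)))
    {(\<sigma>, k). \<sigma> permutes S \<and> k \<in> S \<and> k \<notin> orbit \<sigma> r}
    {(\<sigma>, j). \<sigma> permutes S \<and> 1 \<le> j \<and> j < card (orbit \<sigma> r)}"
proof (rule bij_betwI[where g = "\<lambda>(\<sigma>, j). (\<sigma> \<circ> transpose r ((\<sigma> ^^ j) r), (\<sigma> ^^ j) r)"], goal_cases)
  case 1
  show ?case
  proof (clarsimp, intro conjI)
    fix \<sigma> k assume a: "\<sigma> permutes S" "k \<in> S" "k \<notin> orbit \<sigma> r"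
    have pm: "permutation \<sigma>" using permutes_permutation[OF fin a(1)] .
    show "(\<sigma> \<circ> transpose r k) permutes S" using a r by (intro merge_permutes)
    show "Suc 0 \<le> card (orbit \<sigma> k)" using orbit_enum(4)[OF pm, of k] by simp
    have "orbit \<sigma> r \<inter> orbit \<sigma> k = {}"
      using a(3) pm by (metis disjoint_iff orbit_eq_iff)
    moreover have "finite (orbit \<sigma> x)" for x
      using pm by (intro finite_orbit permutation_self_in_orbit)
    ultimately show "card (orbit \<sigma> k) < card (orbit (\<sigma> \<circ> transpose r k) r)"
      using orbit_enum(4)[OF pm, of r]
      by (simp add: merge_orbit_root[OF fin a(1) r a(2,3)] card_Un_disjoint)
  qed
next
  case 2
  show ?case
  proof (clarsimp, intro conjI)
    fix \<sigma> j assume a: "\<sigma> permutes S" "Suc 0 \<le> j" "j < card (orbit \<sigma> r)"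
    note sp = split_orbit[OF fin a(1) _ a(3)]
    show "(\<sigma> ^^ j) r \<in> S" using sp(3) a(2) permutes_orbit_subset[OF a(1) r] by auto
    then show "(\<sigma> \<circ> transpose r ((\<sigma> ^^ j) r)) permutes S" using a r by (intro merge_permutes)
    show "(\<sigma> ^^ j) r \<notin> orbit (\<sigma> \<circ> transpose r ((\<sigma> ^^ j) r)) r" using sp(1) a(2) by simp
  qed
next
  case (3 x)
  then obtain \<sigma> k where a: "\<sigma> permutes S" "k \<in> S" "k \<notin> orbit \<sigma> r" "x = (\<sigma>, k)" by auto
  have pm: "permutation \<sigma>" using permutes_permutation[OF fin a(1)] .
  have "((\<sigma> \<circ> transpose r k) ^^ card (orbit \<sigma> k)) r = k"
    using merge_funpow[OF fin a(1,3), of "card (orbit \<sigma> k)"] orbit_enum(1,4)[OF pm, of k] by simp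
  then show ?case by (simp add: a(4) comp_assoc)
next
  case (4 x)
  then obtain \<sigma> j where a: "\<sigma> permutes S" "1 \<le> j" "j < card (orbit \<sigma> r)" "x = (\<sigma>, j)" by auto
  then show ?case using split_orbit(2)[OF fin a(1-3)] by (simp add: comp_assoc)
qed


text \<open>
  The type of a permutation records only the cycles that avoid the root; the cycle through the root
  has the remaining length \<open>root_len\<close>. Leaving the root cycle out makes the law of the type a
  truncated product measure: a type \<open>y\<close> has probability \<open>weight n y / n\<close>.
\<close>

definition off_root_size :: "nat \<Rightarrow> (nat \<Rightarrow> nat) \<Rightarrow> nat" where
  "off_root_size n y = (\<Sum>j\<in>{1..<n}. j * y j)"

text \<open>The strict inequality leaves room for a root cycle of length at least 1. Forcing the
  value 0 elsewhere makes the set finite and lets equality of functions mean equality of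
  counts.\<close>

definition rooted_types :: "nat \<Rightarrow> (nat \<Rightarrow> nat) set" where
  "rooted_types n = {y. (\<forall>j. j \<notin> {1..<n} \<longrightarrow> y j = 0) \<and> off_root_size n y < n}"

definition root_len :: "nat \<Rightarrow> (nat \<Rightarrow> nat) \<Rightarrow> nat" where
  "root_len n y = n - off_root_size n y"

definition add_cycle :: "nat \<Rightarrow> (nat \<Rightarrow> nat) \<Rightarrow> nat \<Rightarrow> nat" where
  "add_cycle j y = y(j := Suc (y j))"

text \<open>The factors are those of independent Poisson variables with means 1/j, without the
  normalisation exp (-1/j).\<close>

definition weight :: "nat \<Rightarrow> (nat \<Rightarrow> nat) \<Rightarrow> real" where
  "weight n y = (\<Prod>j\<in>{1..<n}. 1 / (real j ^ y j * fact (y j)))"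

lemma orbits_partition:
  assumes fin: "finite S" and r: "r \<in> S" and \<sigma>: "\<sigma> permutes S"
  shows "\<Union> (orbits_off S r \<sigma>) = S - orbit \<sigma> r"
    and "pairwise disjnt (orbits_off S r \<sigma>)"
    and "C \<in> orbits_off S r \<sigma> \<Longrightarrow> finite C"
    and "C \<in> orbits_off S r \<sigma> \<Longrightarrow> card C \<in> {1..<card S}"
proof -
  have pm: "permutation \<sigma>" using permutes_permutation[OF fin \<sigma>] .
  have self: "x \<in> orbit \<sigma> x" for x using pm by (rule permutation_self_in_orbit)
  show "\<Union> (orbits_off S r \<sigma>) = S - orbit \<sigma> r"
  proof (intro equalityI subsetI)
    fix x assume "x \<in> \<Union> (orbits_off S r \<sigma>)"
    then obtain z where z: "z \<in> S" "x \<in> orbit \<sigma> z" "orbit \<sigma> z \<noteq> orbit \<sigma> r"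
      by (auto simp: orbits_off_def)
    then have "orbit \<sigma> x = orbit \<sigma> z" using orbit_eq_iff[OF pm, of x z] by simp
    then have "x \<notin> orbit \<sigma> r" using z(3) orbit_eq_iff[OF pm, of x r] by simp
    then show "x \<in> S - orbit \<sigma> r"
      using permutes_orbit_subset[OF \<sigma> z(1)] z(2) by blast
  next
    fix x assume x: "x \<in> S - orbit \<sigma> r"
    then have "orbit \<sigma> x \<in> orbits_off S r \<sigma>" using self[of x] by (auto simp: orbits_off_def)
    then show "x \<in> \<Union> (orbits_off S r \<sigma>)" using self[of x] by blast
  qed
  have "disjnt (orbit \<sigma> x) (orbit \<sigma> z)" if "orbit \<sigma> x \<noteq> orbit \<sigma> z" for x z
    using that pm by (metis disjnt_iff orbit_eq_iff)
  then show "pairwise disjnt (orbits_off S r \<sigma>)"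
    by (auto simp: orbits_off_def pairwise_def)
  show fC: "finite C" if "C \<in> orbits_off S r \<sigma>" for C
    using that self by (auto simp: orbits_off_def intro: finite_orbit)
  assume C: "C \<in> orbits_off S r \<sigma>"
  then obtain x where x: "x \<in> S" "C = orbit \<sigma> x" "C \<noteq> orbit \<sigma> r" by (auto simp: orbits_off_def)
  have "C \<subset> S"
  proof
    show "C \<subseteq> S" unfolding x(2) using permutes_orbit_subset[OF \<sigma> x(1)] .
    have "r \<notin> C" using x pm by (metis orbit_eq_iff)
    then show "C \<noteq> S" using r by auto
  qed
  then show "card C \<in> {1..<card S}"
    using psubset_card_mono[OF fin] orbit_enum(4)[OF pm, of x] x(2) by auto
qed

lemma card_orbit_elements:
  assumes fin: "finite S" and r: "r \<in> S" and \<sigma>: "\<sigma> permutes S"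
  shows "card {k \<in> S. k \<notin> orbit \<sigma> r \<and> card (orbit \<sigma> k) = j} = j * cycle_counts S r \<sigma> j"
proof -
  have pm: "permutation \<sigma>" using permutes_permutation[OF fin \<sigma>] .
  note part = orbits_partition[OF fin r \<sigma>]
  let ?F = "{C \<in> orbits_off S r \<sigma>. card C = j}"
  have orb: "orbit \<sigma> k = C" if C: "C \<in> orbits_off S r \<sigma>" "k \<in> C" for C k
  proof -
    obtain x where "C = orbit \<sigma> x" using C(1) by (auto simp: orbits_off_def)
    with C(2) show ?thesis using orbit_eq_iff[OF pm, of k x] by simp
  qed
  have "{k \<in> S. k \<notin> orbit \<sigma> r \<and> card (orbit \<sigma> k) = j} = \<Union> ?F"
  proof (intro equalityI subsetI)
    fix k assume k: "k \<in> {k \<in> S. k \<notin> orbit \<sigma> r \<and> card (orbit \<sigma> k) = j}"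
    then obtain C where "C \<in> orbits_off S r \<sigma>" "k \<in> C" using part(1) by blast
    then show "k \<in> \<Union> ?F" using orb k by blast
  next
    fix k assume "k \<in> \<Union> ?F"
    then obtain C where "C \<in> orbits_off S r \<sigma>" "k \<in> C" "card C = j" by blast
    then show "k \<in> {k \<in> S. k \<notin> orbit \<sigma> r \<and> card (orbit \<sigma> k) = j}"
      using orb part(1) by blast
  qed
  moreover have "card (\<Union> ?F) = sum card ?F"
    using part(2,3) by (intro card_Union_disjoint pairwise_subset[OF part(2)]) auto
  ultimately show ?thesis by (simp add: cycle_counts_def)
qed

lemma cycle_counts_rooted_types:
  assumes fin: "finite S" and r: "r \<in> S" and \<sigma>: "\<sigma> permutes S"
  shows "cycle_counts S r \<sigma> \<in> rooted_types (card S)"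
    and "root_len (card S) (cycle_counts S r \<sigma>) = card (orbit \<sigma> r)"
proof -
  have pm: "permutation \<sigma>" using permutes_permutation[OF fin \<sigma>] .
  note part = orbits_partition[OF fin r \<sigma>]
  have sub: "orbit \<sigma> r \<subseteq> S" using permutes_orbit_subset[OF \<sigma> r] .
  have fo: "finite (orbits_off S r \<sigma>)" using finite_orbits_off[OF fin] .
  have "off_root_size (card S) (cycle_counts S r \<sigma>) =
      (\<Sum>j\<in>{1..<card S}. \<Sum>C\<in>{C \<in> orbits_off S r \<sigma>. card C = j}. card C)"
    by (simp add: off_root_size_def cycle_counts_def mult.commute)
  also have "\<dots> = sum card (orbits_off S r \<sigma>)"
    using fo part(4) by (intro sum.group) auto
  also have "\<dots> = card (S - orbit \<sigma> r)"
    unfolding part(1)[symmetric] using part(2,3) by (intro card_Union_disjoint[symmetric]) auto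
  also have "\<dots> = card S - card (orbit \<sigma> r)"
    using sub fin by (intro card_Diff_subset) (auto intro: finite_subset)
  finally have w: "off_root_size (card S) (cycle_counts S r \<sigma>) = card S - card (orbit \<sigma> r)" .
  have le: "card (orbit \<sigma> r) \<le> card S" using sub fin by (rule card_mono[rotated])
  have pos: "0 < card (orbit \<sigma> r)" using orbit_enum(4)[OF pm] .
  show "root_len (card S) (cycle_counts S r \<sigma>) = card (orbit \<sigma> r)"
    using w le by (simp add: root_len_def)
  have "cycle_counts S r \<sigma> j = 0" if "j \<notin> {1..<card S}" for j
  proof -
    have "{C \<in> orbits_off S r \<sigma>. card C = j} = {}" using part(4) that by blast
    then show ?thesis unfolding cycle_counts_def by (simp only: card.empty)
  qed
  then show "cycle_counts S r \<sigma> \<in> rooted_types (card S)"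
    using w le pos unfolding rooted_types_def by auto
qed

section \<open>Conjugacy and rooted cycle counts\<close>

lemma orbit_conj:
  assumes "finite S" "\<sigma> permutes S" "\<rho> permutes S"
  shows "orbit (\<rho> \<circ> \<sigma> \<circ> inv \<rho>) (\<rho> x) = \<rho> ` orbit \<sigma> x"
  using assms
  by (intro orbit_inverse[symmetric])
    (auto simp: permutes_inverses intro: permutation_self_in_orbit permutes_permutation)

lemma cycle_counts_conj:
  assumes "finite S" "\<sigma> permutes S" "\<rho> permutes S"
  shows "cycle_counts S (\<rho> r) (\<rho> \<circ> \<sigma> \<circ> inv \<rho>) = cycle_counts S r \<sigma>"
proof
  fix j
  have inj: "inj \<rho>" using assms(3) by (rule permutes_inj)
  have inj_im: "inj_on (image \<rho>) X" for X
    using inj by (meson inj_image_eq_iff inj_onI)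
  have "orbit (\<rho> \<circ> \<sigma> \<circ> inv \<rho>) ` S = orbit (\<rho> \<circ> \<sigma> \<circ> inv \<rho>) ` \<rho> ` S"
    by (simp add: permutes_image[OF assms(3)])
  also have "\<dots> = image \<rho> ` orbit \<sigma> ` S"
    by (simp add: image_image orbit_conj[OF assms])
  finally have "orbits_off S (\<rho> r) (\<rho> \<circ> \<sigma> \<circ> inv \<rho>) = image \<rho> ` orbits_off S r \<sigma>"
    by (simp add: orbits_off_def orbit_conj[OF assms] inj_on_image_set_diff[OF inj_im[of UNIV]])
  then have "{C \<in> orbits_off S (\<rho> r) (\<rho> \<circ> \<sigma> \<circ> inv \<rho>). card C = j} =
      image \<rho> ` {C \<in> orbits_off S r \<sigma>. card C = j}"
    by (auto simp: card_image[OF inj_on_subset[OF inj]])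
  then show "cycle_counts S (\<rho> r) (\<rho> \<circ> \<sigma> \<circ> inv \<rho>) j = cycle_counts S r \<sigma> j"
    unfolding cycle_counts_def by (simp add: card_image[OF inj_im])
qed

lemma funpow_card_mod:
  assumes "permutation f"
  shows "(f ^^ i) x = (f ^^ (i mod card (orbit f x))) x"
  using orbit_enum(1)[OF assms, of x] by (metis funpow_mod_eq)

text \<open>The conjugator matches the i-th point after \<open>r\<close> on one cycle with the i-th
  point after \<open>r\<close> on the other; index 0 gives that it fixes \<open>r\<close>.\<close>

lemma full_cycles_conj:
  assumes fin: "finite S" and r: "r \<in> S" and \<sigma>: "\<sigma> permutes S" and \<pi>: "\<pi> permutes S"
    and full: "orbit \<sigma> r = S" "orbit \<pi> r = S"
  shows "\<exists>\<rho>. \<rho> permutes S \<and> \<rho> r = r \<and> \<rho> \<circ> \<sigma> = \<pi> \<circ> \<rho>"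
proof -
  have ps: "permutation \<sigma>" "permutation \<pi>" using permutes_permutation[OF fin] \<sigma> \<pi> by auto
  define n where "n = card S"
  define e where "e \<tau> = (\<lambda>i. (\<tau> ^^ i) r)" for \<tau> :: "'a \<Rightarrow> 'a"
  have bij: "bij_betw (e \<sigma>) {0..<n} S" "bij_betw (e \<pi>) {0..<n} S"
    using orbit_enum(2,3)[OF ps(1), of r] orbit_enum(2,3)[OF ps(2), of r]
    unfolding bij_betw_def e_def n_def full by auto
  define \<rho> where "\<rho> = (\<lambda>x. if x \<in> S then e \<pi> (inv_into {0..<n} (e \<sigma>) x) else x)"
  have "bij_betw (e \<pi> \<circ> inv_into {0..<n} (e \<sigma>)) S S"
    using bij bij_betw_inv_into bij_betw_trans by blast
  then have "bij_betw \<rho> S S"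
    by (rule bij_betw_cong[THEN iffD1, rotated]) (simp add: \<rho>_def)
  then have \<rho>: "\<rho> permutes S" by (rule bij_imp_permutes) (simp add: \<rho>_def)
  have npos: "0 < n" using orbit_enum(4)[OF ps(1), of r] by (simp add: full n_def)
  have val: "\<rho> (e \<sigma> i) = e \<pi> i" for i
  proof -
    have "e \<sigma> i = e \<sigma> (i mod n)" "e \<pi> i = e \<pi> (i mod n)"
      unfolding e_def n_def using funpow_card_mod[OF ps(1), of i r] funpow_card_mod[OF ps(2), of i r]
      by (simp_all add: full)
    moreover have "e \<sigma> (i mod n) \<in> S"
      using bij(1) npos by (auto simp: bij_betw_def)
    ultimately show ?thesis
      using npos bij(1) by (simp add: \<rho>_def bij_betw_def inv_into_f_f)
  qed
  have "\<rho> r = r" using val[of 0] by (simp add: e_def)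
  moreover have "\<rho> \<circ> \<sigma> = \<pi> \<circ> \<rho>"
  proof
    fix x
    show "(\<rho> \<circ> \<sigma>) x = (\<pi> \<circ> \<rho>) x"
    proof (cases "x \<in> S")
      case True
      then obtain i where "x = e \<sigma> i" using bij(1) by (auto simp: bij_betw_def)
      then show ?thesis using val[of i] val[of "Suc i"] by (simp add: e_def)
    next
      case False
      then show ?thesis using \<sigma> \<pi> by (simp add: \<rho>_def permutes_not_in)
    qed
  qed
  ultimately show ?thesis using \<rho> by blast
qed

text \<open>Merge a cycle of the same length \<open>j\<close> into the root cycle on both sides and
  use induction. The conjugator of the merged permutations fixes \<open>r\<close>, and
  \<open>k\<close>, \<open>k'\<close> are the \<open>j\<close>-th iterates of \<open>r\<close>;
  hence it carries \<open>k\<close> to \<open>k'\<close>, commutes with the two transpositions and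
  conjugates the original permutations. For this reason \<open>\<rho> r = r\<close> belongs to the
  statement.\<close>

lemma cycle_counts_eq_imp_conj:
  assumes fin: "finite S" and r: "r \<in> S" and \<sigma>: "\<sigma> permutes S" and \<pi>: "\<pi> permutes S"
    and eq: "cycle_counts S r \<sigma> = cycle_counts S r \<pi>"
  shows "\<exists>\<rho>. \<rho> permutes S \<and> \<rho> r = r \<and> \<rho> \<circ> \<sigma> = \<pi> \<circ> \<rho>"
  using \<sigma> \<pi> eq
proof (induction "card (orbits_off S r \<sigma>)" arbitrary: \<sigma> \<pi> rule: less_induct)
  case (less \<sigma> \<pi>)
  note \<sigma> = less.prems(1) and \<pi> = less.prems(2) and eq = less.prems(3)
  have ps: "permutation \<sigma>" "permutation \<pi>" using permutes_permutation[OF fin] \<sigma> \<pi> by auto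
  show ?case
  proof (cases "orbits_off S r \<sigma> = {}")
    case True
    have full: "orbit \<sigma> r = S"
      using orbits_partition(1)[OF fin r \<sigma>] True permutes_orbit_subset[OF \<sigma> r] by auto
    have "card (orbit \<pi> r) = card S"
      using cycle_counts_rooted_types(2)[OF fin r \<sigma>] cycle_counts_rooted_types(2)[OF fin r \<pi>] eq full by simp
    then have "orbit \<pi> r = S"
      using permutes_orbit_subset[OF \<pi> r] fin by (simp add: card_subset_eq)
    then show ?thesis using full_cycles_conj[OF fin r \<sigma> \<pi> full] by blast
  next
    case False
    then obtain k where k: "k \<in> S" "orbit \<sigma> k \<in> orbits_off S r \<sigma>" "orbit \<sigma> k \<noteq> orbit \<sigma> r"
      by (auto simp: orbits_off_def)
    define j where "j = card (orbit \<sigma> k)"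
    have nk: "k \<notin> orbit \<sigma> r" using k(3) ps(1) by (simp add: orbit_eq_iff)
    have "{C \<in> orbits_off S r \<sigma>. card C = j} \<noteq> {}" using k(2) by (auto simp: j_def)
    then have "cycle_counts S r \<sigma> j > 0"
      using finite_orbits_off[OF fin, of r \<sigma>] by (simp add: cycle_counts_def card_gt_0_iff)
    then have "cycle_counts S r \<pi> j > 0" using eq by simp
    then have "{C \<in> orbits_off S r \<pi>. card C = j} \<noteq> {}"
      unfolding cycle_counts_def by (metis card.empty less_nat_zero_code)
    then obtain k' where k': "k' \<in> S" "orbit \<pi> k' \<noteq> orbit \<pi> r" "card (orbit \<pi> k') = j"
      by (auto simp: orbits_off_def)
    have nk': "k' \<notin> orbit \<pi> r" using k'(2) ps(2) by (simp add: orbit_eq_iff)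
    let ?\<sigma> = "\<sigma> \<circ> transpose r k" and ?\<pi> = "\<pi> \<circ> transpose r k'"
    have perm: "?\<sigma> permutes S" "?\<pi> permutes S"
      using merge_permutes[OF \<sigma> r k(1)] merge_permutes[OF \<pi> r k'(1)] by auto
    have "card (orbits_off S r ?\<sigma>) < card (orbits_off S r \<sigma>)"
      unfolding orbits_off_merge(1)[OF fin \<sigma> r k(1) nk]
      using k(2) finite_orbits_off[OF fin] by (intro card_Diff1_less)
    moreover have "cycle_counts S r ?\<sigma> = cycle_counts S r ?\<pi>"
    proof
      fix i
      have "cycle_counts S r \<sigma> i = cycle_counts S r \<pi> i" using eq by simp
      then show "cycle_counts S r ?\<sigma> i = cycle_counts S r ?\<pi> i"
        unfolding cycle_counts_merge[OF fin \<sigma> r k(1) nk] cycle_counts_merge[OF fin \<pi> r k'(1) nk'] k'(3) j_def[symmetric]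
        by (simp split: if_splits)
    qed
    ultimately obtain \<rho> where \<rho>: "\<rho> permutes S" "\<rho> r = r" "\<rho> \<circ> ?\<sigma> = ?\<pi> \<circ> \<rho>"
      using less.hyps perm by blast
    have j: "1 \<le> j" "j \<le> card (orbit \<sigma> k)" "j \<le> card (orbit \<pi> k')"
      using orbit_enum(4)[OF ps(1), of k] by (simp_all add: j_def[symmetric] k'(3))
    have pow: "\<rho> ((?\<sigma> ^^ i) r) = (?\<pi> ^^ i) r" for i
    proof (induction i)
      case (Suc i)
      have "\<rho> (?\<sigma> ((?\<sigma> ^^ i) r)) = ?\<pi> (\<rho> ((?\<sigma> ^^ i) r))" using fun_cong[OF \<rho>(3)] by simp
      then show ?case unfolding funpow.simps comp_apply[of ?\<sigma> "?\<sigma> ^^ i"] comp_apply[of ?\<pi> "?\<pi> ^^ i"] Suc .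
    qed (simp add: \<rho>(2))
    have "(?\<sigma> ^^ j) r = k" "(?\<pi> ^^ j) r = k'"
      using merge_funpow[OF fin \<sigma> nk j(1,2)] merge_funpow[OF fin \<pi> nk' j(1,3)]
        orbit_enum(1)[OF ps(1), of k] orbit_enum(1)[OF ps(2), of k'] k'(3)
      by (simp_all add: j_def[symmetric])
    then have \<rho>k: "\<rho> k = k'" using pow[of j] by simp
    have comm: "\<rho> \<circ> transpose r k = transpose r k' \<circ> \<rho>"
    proof
      fix x
      show "(\<rho> \<circ> transpose r k) x = (transpose r k' \<circ> \<rho>) x"
        using \<rho>(2) \<rho>k inj_eq[OF permutes_inj[OF \<rho>(1)], of x r] inj_eq[OF permutes_inj[OF \<rho>(1)], of x k]
        by (cases "x = r"; cases "x = k") simp_all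
    qed
    have "\<rho> \<circ> \<sigma> = \<pi> \<circ> \<rho>"
    proof
      fix x
      show "(\<rho> \<circ> \<sigma>) x = (\<pi> \<circ> \<rho>) x"
        using fun_cong[OF \<rho>(3), of "transpose r k x"] fun_cong[OF comm, of "x"] by simp
    qed
    then show ?thesis using \<rho>(1,2) by blast
  qed
qed

section \<open>Number of permutations of a given type\<close>

definition type_count :: "'a set \<Rightarrow> 'a \<Rightarrow> (nat \<Rightarrow> nat) \<Rightarrow> nat" where
  "type_count S r y = card {\<sigma>. \<sigma> permutes S \<and> cycle_counts S r \<sigma> = y}"

text \<open>Double counting along \<open>merge_bij\<close>: a permutation of the larger type has
  \<open>j * Suc (y j)\<close> points on its \<open>j\<close>-cycles, while one of type
  \<open>y\<close> can be cut at distance \<open>j\<close> from the root in exactly one way.\<close>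

lemma type_count_add_cycle:
  assumes fin: "finite S" and r: "r \<in> S"
    and j: "1 \<le> j" "j < root_len (card S) y"
  shows "type_count S r (add_cycle j y) * (j * Suc (y j)) = type_count S r y"
proof -
  let ?D = "{(\<sigma>, k). \<sigma> permutes S \<and> k \<in> S \<and> k \<notin> orbit \<sigma> r}"
  let ?f = "\<lambda>(\<sigma>, k). (\<sigma> \<circ> transpose r k, card (orbit \<sigma> k))"
  let ?X = "SIGMA \<sigma>:{\<sigma>. \<sigma> permutes S \<and> cycle_counts S r \<sigma> = add_cycle j y}. {k \<in> S. k \<notin> orbit \<sigma> r \<and> card (orbit \<sigma> k) = j}"
  let ?Y = "{\<sigma>. \<sigma> permutes S \<and> cycle_counts S r \<sigma> = y} \<times> {j}"
  have finp: "finite {\<sigma>. \<sigma> permutes S \<and> cycle_counts S r \<sigma> = y}" for y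
    using finite_permutations[OF fin] by (rule finite_subset[rotated]) auto
  have add_cycle_inj: "add_cycle j z = add_cycle j y \<longleftrightarrow> z = y" for z
    by (auto simp: add_cycle_def fun_eq_iff)
  have bij: "bij_betw ?f ?X ?Y"
  proof (rule bij_betw_subset[OF merge_bij[OF fin r]])
    show "?X \<subseteq> ?D" by auto
    show "?f ` ?X = ?Y"
    proof (intro equalityI subsetI)
      fix z assume "z \<in> ?f ` ?X"
      then obtain \<sigma> k where a: "\<sigma> permutes S" "cycle_counts S r \<sigma> = add_cycle j y" "k \<in> S" "k \<notin> orbit \<sigma> r"
          "card (orbit \<sigma> k) = j" "z = (\<sigma> \<circ> transpose r k, j)" by auto
      have "cycle_counts S r (\<sigma> \<circ> transpose r k) = y"
        using cycle_counts_merge[OF fin a(1) r a(3,4)] a(2,5) add_cycle_inj[of "cycle_counts S r (\<sigma> \<circ> transpose r k)"]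
        by (simp add: add_cycle_def)
      then show "z \<in> ?Y" using a merge_permutes[OF a(1) r a(3)] by auto
    next
      fix z assume "z \<in> ?Y"
      then obtain \<sigma>' where a: "\<sigma>' permutes S" "cycle_counts S r \<sigma>' = y" "z = (\<sigma>', j)" by auto
      have "j < card (orbit \<sigma>' r)" using j(2) cycle_counts_rooted_types(2)[OF fin r a(1)] a(2) by simp
      then have "z \<in> ?f ` ?D"
        using bij_betw_imp_surj_on[OF merge_bij[OF fin r]] a j(1) by auto
      then obtain \<sigma> k where b: "\<sigma> permutes S" "k \<in> S" "k \<notin> orbit \<sigma> r"
         "\<sigma>' = \<sigma> \<circ> transpose r k" "j = card (orbit \<sigma> k)" unfolding a(3) by auto
      have "cycle_counts S r \<sigma> = add_cycle j y"
        using cycle_counts_merge[OF fin b(1) r b(2,3)] a(2) b(4,5) by (simp add: add_cycle_def)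
      then have "(\<sigma>, k) \<in> ?X" using b by simp
      then show "z \<in> ?f ` ?X" using b a(3) by (intro image_eqI[of _ _ "(\<sigma>, k)"]) auto
    qed
  qed
  have "card ?X = (\<Sum>\<sigma>\<in>{\<sigma>. \<sigma> permutes S \<and> cycle_counts S r \<sigma> = add_cycle j y}. j * Suc (y j))"
  proof (subst card_SigmaI[OF finp])
    show "(\<Sum>\<sigma>\<in>{\<sigma>. \<sigma> permutes S \<and> cycle_counts S r \<sigma> = add_cycle j y}. card {k \<in> S. k \<notin> orbit \<sigma> r \<and> card (orbit \<sigma> k) = j}) =
      (\<Sum>\<sigma>\<in>{\<sigma>. \<sigma> permutes S \<and> cycle_counts S r \<sigma> = add_cycle j y}. j * Suc (y j))"
      by (intro sum.cong) (auto simp: card_orbit_elements[OF fin r] add_cycle_def)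
  qed (use fin in auto)
  then have "card ?X = type_count S r (add_cycle j y) * (j * Suc (y j))" by (simp add: type_count_def)
  moreover have "card ?Y = type_count S r y" by (simp add: type_count_def card_cartesian_product)
  ultimately show ?thesis using bij_betw_same_card[OF bij] by simp
qed

section \<open>Sums over rooted cycle types\<close>

lemma weight_pos: "weight n y > 0"
  unfolding weight_def by (intro prod_pos) auto

lemma rooted_types_le: "y \<in> rooted_types n \<Longrightarrow> y j \<le> n"
proof (cases "j \<in> {1..<n}")
  assume y: "y \<in> rooted_types n"
  case True
  have "y j \<le> j * y j" using True by simp
  also have "\<dots> \<le> off_root_size n y" unfolding off_root_size_def using True by (intro member_le_sum) auto
  also have "\<dots> \<le> n" using y by (simp add: rooted_types_def)
  finally show ?thesis .
qed (simp add: rooted_types_def)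

lemma finite_rooted_types: "finite (rooted_types n)"
proof (rule finite_subset)
  show "rooted_types n \<subseteq> {y. \<forall>j. (j \<in> {1..<n} \<longrightarrow> y j \<in> {..n}) \<and> (j \<notin> {1..<n} \<longrightarrow> y j = 0)}"
    using rooted_types_le by (auto simp: rooted_types_def)
qed (intro finite_set_of_finite_funs; simp)

lemma off_root_size_upd:
  assumes "j \<in> {1..<n}"
  shows "off_root_size n (y(j := x)) + j * y j = off_root_size n y + j * x"
  using assms by (simp add: off_root_size_def sum.remove[of _ j] if_distrib cong: if_cong)

lemma weight_upd:
  assumes "j \<in> {1..<n}"
  shows "weight n (y(j := x)) = weight n (y(j := 0)) / (real j ^ x * fact x)"
proof -
  have "weight n (y(j := z)) = (1 / (real j ^ z * fact z)) * (\<Prod>i\<in>{1..<n} - {j}. 1 / (real i ^ y i * fact (y i)))" for z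
    unfolding weight_def using assms by (subst prod.remove[of _ j]) (auto intro!: arg_cong2[of _ _ _ _ "(*)"] prod.cong)
  from this[of x] this[of 0] show ?thesis by simp
qed

lemma weight_add_cycle:
  assumes "j \<in> {1..<n}"
  shows "weight n (add_cycle j y) * real (j * Suc (y j)) = weight n y"
proof -
  have base: "weight n y = weight n (y(j := 0)) / (real j ^ y j * fact (y j))"
    using weight_upd[OF assms, of y "y j"] by simp
  have "weight n (add_cycle j y) = weight n (y(j := 0)) / (real j ^ Suc (y j) * fact (Suc (y j)))"
    unfolding add_cycle_def by (rule weight_upd[OF assms])
  then have "weight n (add_cycle j y) = weight n (y(j := 0)) / (real j ^ y j * fact (y j)) / real (j * Suc (y j))"
    by (simp add: algebra_simps)
  then have "weight n (add_cycle j y) = weight n y / real (j * Suc (y j))"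
    unfolding base .
  moreover have "real (j * Suc (y j)) \<noteq> 0" unfolding of_nat_eq_0_iff using assms by simp
  ultimately show ?thesis by (metis nonzero_eq_divide_eq)
qed

lemma root_len_rooted_types: "y \<in> rooted_types n \<Longrightarrow> root_len n y \<in> {1..n} \<and> off_root_size n y + root_len n y = n"
  by (auto simp: rooted_types_def root_len_def)

lemma add_cycle_rooted_types:
  assumes y: "y \<in> rooted_types n" and j: "1 \<le> j" "j < root_len n y"
  shows "add_cycle j y \<in> rooted_types n" "root_len n (add_cycle j y) = root_len n y - j" "j \<in> {1..<n}"
proof -
  show jn: "j \<in> {1..<n}" using j by (auto simp: root_len_def)
  have "off_root_size n (add_cycle j y) = off_root_size n y + j"
    using off_root_size_upd[OF jn, of y "Suc (y j)"] by (simp add: add_cycle_def)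
  then show "add_cycle j y \<in> rooted_types n" "root_len n (add_cycle j y) = root_len n y - j"
    using y j jn by (auto simp: rooted_types_def root_len_def add_cycle_def)
qed

lemma decr_rooted_types:
  assumes y: "y \<in> rooted_types n" and j: "y j > 0"
  shows "y(j := y j - 1) \<in> rooted_types n" "add_cycle j (y(j := y j - 1)) = y" "1 \<le> j" "j < root_len n (y(j := y j - 1))"
    "off_root_size n (y(j := y j - 1)) < off_root_size n y"
proof -
  have jn: "j \<in> {1..<n}" using y j by (auto simp: rooted_types_def)
  then show "1 \<le> j" by simp
  have w: "off_root_size n (y(j := y j - 1)) + j = off_root_size n y"
    using off_root_size_upd[OF jn, of y "y j - 1"] j by (cases "y j") simp_all
  then show "y(j := y j - 1) \<in> rooted_types n" "j < root_len n (y(j := y j - 1))"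
    using y jn by (auto simp: rooted_types_def root_len_def)
  show "add_cycle j (y(j := y j - 1)) = y" using j by (auto simp: add_cycle_def)
  show "off_root_size n (y(j := y j - 1)) < off_root_size n y" using w jn by simp
qed

text \<open>The size-bias (Mecke) identity for Poisson variables: the factor \<open>j * y j\<close>
  turns the weight of \<open>y\<close> into that of \<open>y\<close> with one \<open>j\<close>-cycle
  removed. Combinatorially, a random point on a \<open>j\<close>-cycle is traded for a cut of the
  root cycle.\<close>

lemma sum_shift:
  "(\<Sum>y\<in>rooted_types n. \<Sum>j\<in>{1..<n}. weight n y * real (j * y j) * F y j) =
   (\<Sum>y\<in>rooted_types n. \<Sum>j\<in>{1..<root_len n y}. weight n y * F (add_cycle j y) j)"
proof -
  let ?L = "SIGMA y:rooted_types n. {j \<in> {1..<n}. y j > 0}"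
  let ?R = "SIGMA y:rooted_types n. {1..<root_len n y}"
  have "(\<Sum>y\<in>rooted_types n. \<Sum>j\<in>{1..<n}. weight n y * real (j * y j) * F y j) =
      (\<Sum>y\<in>rooted_types n. \<Sum>j\<in>{j \<in> {1..<n}. y j > 0}. weight n y * real (j * y j) * F y j)"
    by (intro sum.cong refl sum.mono_neutral_right) auto
  also have "\<dots> = (\<Sum>(y, j)\<in>?L. weight n y * real (j * y j) * F y j)"
    by (rule sum.Sigma) (auto simp: finite_rooted_types)
  also have "\<dots> = (\<Sum>(y, j)\<in>?R. weight n y * F (add_cycle j y) j)"
  proof (rule sum.reindex_bij_witness[of _ "\<lambda>(y, j). (add_cycle j y, j)" "\<lambda>(y, j). (y(j := y j - 1), j)"], goal_cases)
    case (1 a)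
    then show ?case using decr_rooted_types(2) by auto
  next
    case (2 a)
    then show ?case using decr_rooted_types by auto
  next
    case (3 b)
    then show ?case by (auto simp: add_cycle_def)
  next
    case (4 b)
    then show ?case using add_cycle_rooted_types by (force simp: add_cycle_def)
  next
    case (5 a)
    then obtain y j where a: "a = (y, j)" "y \<in> rooted_types n" "j \<in> {1..<n}" "y j > 0" by auto
    have "weight n y * real (j * y j) = weight n (y(j := y j - 1))"
      using weight_add_cycle[OF a(3), of "y(j := y j - 1)"] decr_rooted_types(2)[OF a(2,4)] a(4) by simp
    then show ?case using decr_rooted_types(2)[OF a(2,4)] by (simp add: a(1))
  qed
  also have "\<dots> = (\<Sum>y\<in>rooted_types n. \<Sum>j\<in>{1..<root_len n y}. weight n y * F (add_cycle j y) j)"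
    by (rule sum.Sigma[symmetric]) (auto simp: finite_rooted_types)
  finally show ?thesis .
qed

text \<open>The root length is uniformly distributed. Multiplying the mass T k of level k by k, the
  sum of all \<open>j * y j\<close>, and shifting gives k * T k = T 0 + ... + T (k - 1), and T 0 = 1
  comes from the zero type.\<close>

lemma sum_weight_level:
  assumes "k < n"
  shows "(\<Sum>y\<in>{y \<in> rooted_types n. off_root_size n y = k}. weight n y) = 1"
  using assms
proof (induction k rule: less_induct)
  case (less k)
  define T where "T i = (\<Sum>y\<in>{y \<in> rooted_types n. off_root_size n y = i}. weight n y)" for i
  show ?case
  proof (cases "k = 0")
    case True
    have "{y \<in> rooted_types n. off_root_size n y = 0} = {\<lambda>_. 0}"
    proof (intro equalityI subsetI)
      fix y assume "y \<in> {y \<in> rooted_types n. off_root_size n y = 0}"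
      then show "y \<in> {\<lambda>_. 0}" by (auto simp: rooted_types_def off_root_size_def fun_eq_iff)
    qed (use less.prems in \<open>auto simp: rooted_types_def off_root_size_def\<close>)
    then show ?thesis using True by (simp add: weight_def)
  next
    case False
    have "real k * T k = (\<Sum>y\<in>rooted_types n. if off_root_size n y = k then weight n y * real (off_root_size n y) else 0)"
      unfolding T_def sum_distrib_left
      by (subst sum.inter_filter[OF finite_rooted_types, symmetric]) (auto intro!: sum.cong)
    also have "\<dots> = (\<Sum>y\<in>rooted_types n. \<Sum>j\<in>{1..<n}. weight n y * real (j * y j) * (if off_root_size n y = k then 1 else 0))"
    proof (intro sum.cong refl)
      fix y
      have "real (off_root_size n y) = (\<Sum>j\<in>{1..<n}. real (j * y j))" by (simp add: off_root_size_def)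
      then show "(if off_root_size n y = k then weight n y * real (off_root_size n y) else 0) =
          (\<Sum>j\<in>{1..<n}. weight n y * real (j * y j) * (if off_root_size n y = k then 1 else 0))"
        unfolding sum_distrib_left[symmetric] sum_distrib_right[symmetric] by simp
    qed
    also have "\<dots> = (\<Sum>y\<in>rooted_types n. \<Sum>j\<in>{1..<root_len n y}. weight n y * (if off_root_size n (add_cycle j y) = k then 1 else 0))"
      by (rule sum_shift)
    also have "\<dots> = (\<Sum>y\<in>rooted_types n. if off_root_size n y < k then weight n y else 0)"
    proof (intro sum.cong refl)
      fix y assume y: "y \<in> rooted_types n"
      have "off_root_size n (add_cycle j y) = off_root_size n y + j" if "j \<in> {1..<root_len n y}" for j
        using add_cycle_rooted_types(1,2)[OF y, of j] that by (auto simp: rooted_types_def root_len_def)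
      then have "(\<Sum>j\<in>{1..<root_len n y}. weight n y * (if off_root_size n (add_cycle j y) = k then 1 else 0)) =
          (\<Sum>j\<in>{1..<root_len n y}. if off_root_size n y + j = k then weight n y else 0)"
        by (intro sum.cong) auto
      \<comment> \<open>From a lower level exactly one \<open>j\<close> leads to level
        \<open>k\<close>; it is below the root length because \<open>k < n\<close>.\<close>
      also have "\<dots> = (\<Sum>j\<in>{1..<root_len n y}. if j = k - off_root_size n y \<and> off_root_size n y < k then weight n y else 0)"
        by (intro sum.cong) auto
      also have "\<dots> = (if off_root_size n y < k then weight n y else 0)"
        using less.prems by (auto simp: root_len_def)
      finally show "(\<Sum>j\<in>{1..<root_len n y}. weight n y * (if off_root_size n (add_cycle j y) = k then 1 else 0)) =
          (if off_root_size n y < k then weight n y else 0)" .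
    qed
    also have "\<dots> = (\<Sum>y\<in>{y \<in> rooted_types n. off_root_size n y < k}. weight n y)"
      by (simp add: sum.inter_filter[OF finite_rooted_types])
    also have "\<dots> = (\<Sum>i\<in>{..<k}. \<Sum>y\<in>{y \<in> {y \<in> rooted_types n. off_root_size n y < k}. off_root_size n y = i}. weight n y)"
      by (intro sum.group[symmetric]) (auto simp: finite_rooted_types)
    also have "\<dots> = (\<Sum>i\<in>{..<k}. T i)"
      unfolding T_def by (intro sum.cong refl arg_cong2[of _ _ _ _ sum]) auto
    also have "\<dots> = real k" using less.IH less.prems by (simp add: T_def)
    finally show ?thesis using False by (simp add: T_def)
  qed
qed

lemma sum_weight_root_len:
  "(\<Sum>y\<in>rooted_types n. weight n y * \<phi> (root_len n y)) = (\<Sum>l\<in>{1..n}. \<phi> l)"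
proof -
  have "(\<Sum>y\<in>rooted_types n. weight n y * \<phi> (root_len n y)) =
      (\<Sum>l\<in>{1..n}. \<Sum>y\<in>{y \<in> rooted_types n. root_len n y = l}. weight n y * \<phi> (root_len n y))"
    using root_len_rooted_types by (intro sum.group[symmetric]) (auto simp: finite_rooted_types)
  also have "\<dots> = (\<Sum>l\<in>{1..n}. (\<Sum>y\<in>{y \<in> rooted_types n. off_root_size n y = n - l}. weight n y) * \<phi> l)"
  proof (intro sum.cong refl)
    fix l assume l: "l \<in> {1..n}"
    have "{y \<in> rooted_types n. root_len n y = l} = {y \<in> rooted_types n. off_root_size n y = n - l}"
      using l by (auto simp: rooted_types_def root_len_def)
    then show "(\<Sum>y\<in>{y \<in> rooted_types n. root_len n y = l}. weight n y * \<phi> (root_len n y)) =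
        (\<Sum>y\<in>{y \<in> rooted_types n. off_root_size n y = n - l}. weight n y) * \<phi> l"
      unfolding sum_distrib_right by (intro sum.cong) auto
  qed
  also have "\<dots> = (\<Sum>l\<in>{1..n}. \<phi> l)"
    by (intro sum.cong) (auto simp: sum_weight_level)
  finally show ?thesis .
qed

lemma sum_weight: "(\<Sum>y\<in>rooted_types n. weight n y) = n"
  using sum_weight_root_len[of n "\<lambda>_. 1"] by simp

section \<open>Two power sums\<close>

lemma sum_inverse_sqrt_le: "(\<Sum>l\<in>{1..n}. 1 / sqrt (real l)) \<le> 2 * sqrt (real n)"
proof (induction n)
  case (Suc n)
  define u v where "u = sqrt (real (Suc n))" and "v = sqrt (real n)"
  have "u > 0" "u * u = v * v + 1" by (auto simp: u_def v_def)
  moreover have "0 \<le> (u - v)\<^sup>2" by simp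
  ultimately have "1 / u \<le> 2 * u - 2 * v"
    by (simp add: field_simps power2_eq_square)
  then show ?case using Suc by (simp add: u_def v_def)
qed simp

text \<open>Telescoping with fourth roots: for u^4 = n + 1 and v^4 = n, the identity 1 = u^4 - v^4
  yields 1 / u^3 \<le> 4 (u - v).\<close>

lemma sum_powr_three_quarters_le: "(\<Sum>a\<in>{1..n}. (real n / real a) powr (3/4)) \<le> 4 * real n"
proof -
  have "(\<Sum>a\<in>{1..n}. real a powr (- 3/4)) \<le> 4 * real n powr (1/4)"
  proof (induction n)
    case (Suc n)
    define u v where "u = real (Suc n) powr (1/4)" and "v = real n powr (1/4)"
    have u: "u > 0" "v \<ge> 0" by (auto simp: u_def v_def)
    have "v \<le> u" unfolding u_def v_def by (intro powr_mono2) auto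
    have "u ^ 4 = real (Suc n)" unfolding u_def by (subst powr_realpow[symmetric]) (auto simp: powr_powr)
    moreover have "v ^ 4 = real n"
      unfolding v_def by (cases "n = 0") (simp, subst powr_realpow[symmetric], auto simp: powr_powr)
    ultimately have uv: "u ^ 4 = v ^ 4 + 1" by simp
    have "real (Suc n) powr (- 3/4) = u powr (-3)" unfolding u_def by (simp add: powr_powr)
    also have "\<dots> = 1 / u ^ 3" using u by (simp add: powr_minus_divide powr_numeral)
    also have "\<dots> \<le> 4 * u - 4 * v"
    proof -
      have "u ^ 4 - v ^ 4 = (u - v) * (u ^ 3 + u ^ 2 * v + u * v ^ 2 + v ^ 3)"
        by (simp add: algebra_simps eval_nat_numeral)
      also have "\<dots> \<le> (u - v) * (4 * u ^ 3)"
      proof (intro mult_left_mono)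
        have "u\<^sup>2 * v \<le> u\<^sup>2 * u" "u * v\<^sup>2 \<le> u * u\<^sup>2" "v ^ 3 \<le> u ^ 3"
          using u \<open>v \<le> u\<close> by (auto intro!: mult_left_mono power_mono)
        then show "u ^ 3 + u\<^sup>2 * v + u * v\<^sup>2 + v ^ 3 \<le> 4 * u ^ 3"
          by (simp add: eval_nat_numeral)
      qed (use \<open>v \<le> u\<close> in simp)
      finally show ?thesis using uv u by (simp add: field_simps)
    qed
    finally show ?case using Suc by (simp add: u_def v_def)
  qed simp
  then have "real n powr (3/4) * (\<Sum>a\<in>{1..n}. real a powr (- 3/4)) \<le> real n powr (3/4) * (4 * real n powr (1/4))"
    by (intro mult_left_mono) auto
  also have "\<dots> = 4 * real n" by (cases "n = 0") (auto simp: powr_add[symmetric])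
  finally show ?thesis
    by (simp add: sum_distrib_left powr_divide powr_minus_divide cong: sum.cong)
qed

text \<open>Each side counts all cycles of length \<open>t\<close>, the root cycle included, and
  this number does not depend on the root.\<close>

lemma cycle_counts_root_change:
  assumes fin: "finite S" and \<sigma>: "\<sigma> permutes S" and S: "r \<in> S" "x \<in> S" and x: "x \<notin> orbit \<sigma> r"
  shows "cycle_counts S x \<sigma> t + (if t = card (orbit \<sigma> x) then 1 else 0) =
    cycle_counts S r \<sigma> t + (if t = card (orbit \<sigma> r) then 1 else 0)"
proof -
  have pm: "permutation \<sigma>" using permutes_permutation[OF fin \<sigma>] .
  have aux: "card {C \<in> orbit \<sigma> ` S. card C = t} = cycle_counts S z \<sigma> t + (if t = card (orbit \<sigma> z) then 1 else 0)"
    if z: "z \<in> S" for z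
  proof -
    have "{C \<in> orbit \<sigma> ` S. card C = t} = {C \<in> orbits_off S z \<sigma>. card C = t} \<union>
        (if t = card (orbit \<sigma> z) then {orbit \<sigma> z} else {})"
      using z by (auto simp: orbits_off_def)
    moreover have "finite {C \<in> orbits_off S z \<sigma>. card C = t}"
      using finite_orbits_off[OF fin] by simp
    moreover have "orbit \<sigma> z \<notin> orbits_off S z \<sigma>" by (simp add: orbits_off_def)
    ultimately show ?thesis unfolding cycle_counts_def by auto
  qed
  show ?thesis using aux[OF S(1)] aux[OF S(2)] by simp
qed

lemma sum_type_count:
  assumes fin: "finite S" and r: "r \<in> S"
  shows "(\<Sum>\<sigma>\<in>{\<sigma>. \<sigma> permutes S}. g (cycle_counts S r \<sigma>)) = (\<Sum>y\<in>rooted_types (card S). real (type_count S r y) * g y)"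
proof -
  have "(\<Sum>\<sigma>\<in>{\<sigma>. \<sigma> permutes S}. g (cycle_counts S r \<sigma>)) =
      (\<Sum>y\<in>rooted_types (card S). \<Sum>\<sigma>\<in>{\<sigma> \<in> {\<sigma>. \<sigma> permutes S}. cycle_counts S r \<sigma> = y}. g (cycle_counts S r \<sigma>))"
    using cycle_counts_rooted_types(1)[OF fin r] finite_permutations[OF fin]
    by (intro sum.group[symmetric]) (auto simp: finite_rooted_types)
  also have "\<dots> = (\<Sum>y\<in>rooted_types (card S). real (type_count S r y) * g y)"
    by (simp add: type_count_def)
  finally show ?thesis .
qed

text \<open>\<open>type_count\<close> and \<open>weight\<close> obey the same recursion when a cycle
  is added, so they are proportional. Comparing the totals, n! permutations against mass n, gives
  the factor (n - 1)!.\<close>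

lemma type_count_eq:
  assumes fin: "finite S" and r: "r \<in> S" and y: "y \<in> rooted_types (card S)"
  shows "real (type_count S r y) = fact (card S - 1) * weight (card S) y"
proof -
  let ?n = "card S"
  have npos: "?n > 0" using fin r by (auto simp: card_gt_0_iff)
  have rel: "real (type_count S r y) = real (type_count S r (\<lambda>_. 0)) * weight ?n y" if "y \<in> rooted_types ?n" for y
    using that
  proof (induction "off_root_size ?n y" arbitrary: y rule: less_induct)
    case less
    show ?case
    proof (cases "y = (\<lambda>_. 0)")
      case True
      then show ?thesis by (simp add: weight_def)
    next
      case False
      then obtain j where j: "y j > 0" by (auto simp: fun_eq_iff)
      define z where "z = y(j := y j - 1)"
      note d = decr_rooted_types[OF less.prems j, folded z_def]
      have jn: "j \<in> {1..<?n}" using add_cycle_rooted_types(3)[OF d(1,3,4)] .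
      have c: "real (j * Suc (z j)) \<noteq> 0" unfolding of_nat_eq_0_iff using d(3) by simp
      have "real (type_count S r y) * real (j * Suc (z j)) = real (type_count S r z)"
        using type_count_add_cycle[OF fin r d(3,4)] unfolding d(2) by (metis of_nat_mult)
      also have "\<dots> = real (type_count S r (\<lambda>_. 0)) * weight ?n z"
        using less.hyps[OF d(5) d(1)] .
      also have "weight ?n z = weight ?n y * real (j * Suc (z j))"
        using weight_add_cycle[OF jn, of z] unfolding d(2) by simp
      finally have "real (type_count S r y) * real (j * Suc (z j)) =
          (real (type_count S r (\<lambda>_. 0)) * weight ?n y) * real (j * Suc (z j))" by (simp only: mult.assoc)
      with c show ?thesis by (simp only: mult_cancel_right) simp
    qed
  qed
  have "fact ?n = (\<Sum>y\<in>rooted_types ?n. real (type_count S r y))"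
    using sum_type_count[OF fin r, of "\<lambda>_. 1"] card_permutations[OF refl fin] by simp
  also have "\<dots> = real (type_count S r (\<lambda>_. 0)) * real ?n"
    using rel sum_weight[of ?n] by (simp add: sum_distrib_left[symmetric])
  finally have "real (type_count S r (\<lambda>_. 0)) * real ?n = fact (?n - 1) * real ?n"
    using npos by (simp add: fact_reduce)
  then have "real (type_count S r (\<lambda>_. 0)) = fact (?n - 1)" using npos by simp
  then show ?thesis using rel[OF y] by simp
qed

lemma sum_permutes_cycle_counts:
  assumes "finite S" and "r \<in> S"
  shows "(\<Sum>\<sigma>\<in>{\<sigma>. \<sigma> permutes S}. g (cycle_counts S r \<sigma>)) =
    fact (card S - 1) * (\<Sum>y\<in>rooted_types (card S). weight (card S) y * g y)"
  unfolding sum_type_count[OF assms] sum_distrib_left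
  using type_count_eq[OF assms] by (intro sum.cong) (auto simp: mult.assoc)

lemma card_permutes_cycle_counts:
  assumes fin: "finite S" and r: "r \<in> S" and B: "B \<subseteq> rooted_types (card S)"
  shows "real (card {\<sigma>. \<sigma> permutes S \<and> cycle_counts S r \<sigma> \<in> B}) = fact (card S - 1) * (\<Sum>y\<in>B. weight (card S) y)"
proof -
  have "real (card {\<sigma>. \<sigma> permutes S \<and> cycle_counts S r \<sigma> \<in> B}) =
      (\<Sum>\<sigma>\<in>{\<sigma>. \<sigma> permutes S}. if cycle_counts S r \<sigma> \<in> B then 1 else 0)"
    using sum.inter_filter[OF finite_permutations[OF fin], of "\<lambda>_. 1 :: real" "\<lambda>\<sigma>. cycle_counts S r \<sigma> \<in> B"]
    by simp
  also have "\<dots> = fact (card S - 1) * (\<Sum>y\<in>rooted_types (card S). weight (card S) y * (if y \<in> B then 1 else 0))"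
    by (rule sum_permutes_cycle_counts[OF fin r])
  also have "(\<Sum>y\<in>rooted_types (card S). weight (card S) y * (if y \<in> B then 1 else 0)) = (\<Sum>y\<in>B. weight (card S) y)"
    using B by (intro sum.mono_neutral_cong_right finite_rooted_types) auto
  finally show ?thesis .
qed

text \<open>Along \<open>merge_bij\<close> a crossing pair becomes a permutation of some type
  \<open>y\<close> together with a length \<open>j\<close> whose edge to
  \<open>add_cycle j y\<close> crosses. The edge is charged with the weight of its lower end
  \<open>y\<close>, which is \<open>j * Suc (y j)\<close> times the weight of the upper end.\<close>

lemma card_merge_boundary:
  fixes S :: "'a set" and B :: "(nat \<Rightarrow> nat) set"
  assumes fin: "finite S" and r: "r \<in> S"
  defines "A \<equiv> {\<sigma>. \<sigma> permutes S \<and> cycle_counts S r \<sigma> \<in> B}"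
  shows "real (card {(\<sigma>, k). \<sigma> permutes S \<and> k \<in> S \<and> k \<notin> orbit \<sigma> r \<and> (\<sigma> \<in> A) \<noteq> (\<sigma> \<circ> transpose r k \<in> A)}) =
    fact (card S - 1) * (\<Sum>y\<in>rooted_types (card S). weight (card S) y *
      real (card {j \<in> {1..<root_len (card S) y}. (y \<in> B) \<noteq> (add_cycle j y \<in> B)}))"
proof -
  let ?D = "{(\<sigma>, k). \<sigma> permutes S \<and> k \<in> S \<and> k \<notin> orbit \<sigma> r}"
  let ?f = "\<lambda>(\<sigma>, k). (\<sigma> \<circ> transpose r k, card (orbit \<sigma> k))"
  let ?X = "{(\<sigma>, k). \<sigma> permutes S \<and> k \<in> S \<and> k \<notin> orbit \<sigma> r \<and> (\<sigma> \<in> A) \<noteq> (\<sigma> \<circ> transpose r k \<in> A)}"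
  let ?J = "\<lambda>y. {j \<in> {1..<root_len (card S) y}. (y \<in> B) \<noteq> (add_cycle j y \<in> B)}"
  let ?Y = "SIGMA \<sigma>:{\<sigma>. \<sigma> permutes S}. ?J (cycle_counts S r \<sigma>)"
  have iff: "(\<sigma>, k) \<in> ?X \<longleftrightarrow> ?f (\<sigma>, k) \<in> ?Y" if a: "\<sigma> permutes S" "k \<in> S" "k \<notin> orbit \<sigma> r" for \<sigma> k
  proof -
    have c: "cycle_counts S r \<sigma> = add_cycle (card (orbit \<sigma> k)) (cycle_counts S r (\<sigma> \<circ> transpose r k))"
      unfolding add_cycle_def by (rule cycle_counts_merge[OF fin a(1) r a(2,3)])
    have p: "(\<sigma> \<circ> transpose r k) permutes S" using merge_permutes[OF a(1) r a(2)] .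
    have "?f (\<sigma>, k) \<in> {(\<sigma>, j). \<sigma> permutes S \<and> 1 \<le> j \<and> j < card (orbit \<sigma> r)}"
      using a by (intro bij_betw_apply[OF merge_bij[OF fin r]]) simp
    then have "card (orbit \<sigma> k) \<in> {1..<root_len (card S) (cycle_counts S r (\<sigma> \<circ> transpose r k))}"
      using cycle_counts_rooted_types(2)[OF fin r p] by simp
    then show ?thesis using a p c by (auto simp: A_def)
  qed
  have "bij_betw ?f ?X ?Y"
  proof (rule bij_betw_subset[OF merge_bij[OF fin r]])
    show "?X \<subseteq> ?D" by auto
    show "?f ` ?X = ?Y"
    proof (intro equalityI subsetI)
      fix z assume "z \<in> ?f ` ?X"
      then obtain x where x: "x \<in> ?X" "z = ?f x" by blast
      obtain \<sigma> k where sk: "x = (\<sigma>, k)" by (cases x)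
      show "z \<in> ?Y" unfolding x(2) sk by (rule iff[THEN iffD1]) (use x(1) sk in auto)
    next
      fix z assume z: "z \<in> ?Y"
      then have "z \<in> {(\<sigma>, j). \<sigma> permutes S \<and> 1 \<le> j \<and> j < card (orbit \<sigma> r)}"
        using cycle_counts_rooted_types(2)[OF fin r] by auto
      then have "z \<in> ?f ` ?D" using bij_betw_imp_surj_on[OF merge_bij[OF fin r]] by simp
      then obtain x where x: "x \<in> ?D" "z = ?f x" by blast
      obtain \<sigma> k where sk: "x = (\<sigma>, k)" by (cases x)
      have "x \<in> ?X" unfolding sk by (rule iff[THEN iffD2]) (use x z sk in auto)
      then show "z \<in> ?f ` ?X" unfolding x(2) by (rule imageI)
    qed
  qed
  then have "card ?X = card ?Y" by (rule bij_betw_same_card)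
  also have "\<dots> = (\<Sum>\<sigma>\<in>{\<sigma>. \<sigma> permutes S}. card (?J (cycle_counts S r \<sigma>)))"
    using finite_permutations[OF fin] by (intro card_SigmaI) auto
  finally have "real (card ?X) = (\<Sum>\<sigma>\<in>{\<sigma>. \<sigma> permutes S}. real (card (?J (cycle_counts S r \<sigma>))))" by simp
  also have "\<dots> = fact (card S - 1) * (\<Sum>y\<in>rooted_types (card S). weight (card S) y * real (card (?J y)))"
    by (rule sum_permutes_cycle_counts[OF fin r])
  finally show ?thesis .
qed

section \<open>Entropy of sections\<close>

lemma finite_section:
  fixes B :: "('i \<Rightarrow> 'b) set"
  assumes "finite B"
  shows "finite {x. y(j := x) \<in> B}"
proof -
  have "x = (y(j := x)) j" for x by simp
  then have "{x. y(j := x) \<in> B} \<subseteq> (\<lambda>y. y j) ` B" by blast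
  then show ?thesis using assms finite_surj by blast
qed

text \<open>
  Subadditivity of entropy for the uniform density on \<open>B\<close>. The weights \<open>m j\<close> need not be normalised:
  the proof only compares the sum over \<open>B\<close> with the sum over the product of its projections.
\<close>

lemma sum_ln_sections_le:
  fixes m :: "'i \<Rightarrow> nat \<Rightarrow> real"
  assumes "finite I" and "finite B" and "\<And>y j. y \<in> B \<Longrightarrow> j \<notin> I \<Longrightarrow> y j = 0"
    and "\<And>j x. j \<in> I \<Longrightarrow> m j x > 0"
  defines "S \<equiv> \<Sum>y\<in>B. \<Prod>j\<in>I. m j (y j)"
  shows "(\<Sum>y\<in>B. (\<Prod>j\<in>I. m j (y j)) * (\<Sum>j\<in>I. ln (\<Sum>x\<in>{x. y(j := x) \<in> B}. m j x))) \<le> S * ln S"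
  using assms(1-4) unfolding S_def
proof (induction I arbitrary: B rule: finite_induct)
  case empty
  then have "B \<subseteq> {\<lambda>_. 0}" by (auto simp: fun_eq_iff)
  then show ?case by (auto simp: subset_singleton_iff)
next
  case (insert k I)
  note finB = insert.prems(1) and zero = insert.prems(2) and m = insert.prems(3)
  \<comment> \<open>One coordinate \<open>k\<close> is split off: \<open>c\<close> forgets it,
    \<open>L v\<close> is the slice of \<open>B\<close> at the value \<open>v\<close> and
    \<open>q v\<close> its mass, \<open>P u\<close> is the mass of the fibre over
    \<open>u\<close>.\<close>
  define W where "W u = (\<Prod>j\<in>I. m j (u j))" for u
  define c where "c y = y(k := 0)" for y :: "'i \<Rightarrow> nat"
  define V where "V = (\<lambda>y. y k) ` B"
  define U where "U = c ` B"
  define L where "L v = c ` {y \<in> B. y k = v}" for v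
  define q where "q v = (\<Sum>u\<in>L v. W u)" for v
  define P where "P u = (\<Sum>x\<in>{x. u(k := x) \<in> B}. m k x)" for u
  define S where "S = (\<Sum>y\<in>B. m k (y k) * W (c y))"
  have Wpos: "W u > 0" for u unfolding W_def using m by (intro prod_pos) auto
  have Wc: "(\<Prod>j\<in>insert k I. m j (y j)) = m k (y k) * W (c y)" for y
  proof -
    have "(\<Prod>j\<in>I. m j (y j)) = W (c y)"
      unfolding W_def c_def using insert.hyps(2) by (intro prod.cong) auto
    then show ?thesis using insert.hyps by simp
  qed
  have c_inj: "c y = c z \<Longrightarrow> y k = z k \<Longrightarrow> y = z" for y z
    unfolding c_def by (metis fun_upd_triv fun_upd_upd)
  have cP: "P (c y) = (\<Sum>x\<in>{x. y(k := x) \<in> B}. m k x)" for y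
    unfolding P_def c_def by simp
  have sumV: "(\<Sum>y\<in>B. h y) = (\<Sum>v\<in>V. \<Sum>y\<in>{y \<in> B. y k = v}. h y)" for h :: "_ \<Rightarrow> real"
    using finB by (intro sum.group[symmetric]) (auto simp: V_def)
  have sumL: "(\<Sum>u\<in>L v. h u) = (\<Sum>y\<in>{y \<in> B. y k = v}. h (c y))" for h :: "_ \<Rightarrow> real" and v
    unfolding L_def by (subst sum.reindex) (auto intro!: inj_onI dest: c_inj)
  have S_V: "S = (\<Sum>v\<in>V. m k v * q v)"
    unfolding S_def sumV q_def sumL sum_distrib_left by (intro sum.cong) auto
  have S_U: "S = (\<Sum>u\<in>U. W u * P u)"
  proof -
    have "S = (\<Sum>u\<in>U. \<Sum>y\<in>{y \<in> B. c y = u}. m k (y k) * W (c y))"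
      unfolding S_def using finB by (intro sum.group[symmetric]) (auto simp: U_def)
    also have "\<dots> = (\<Sum>u\<in>U. W u * P u)"
    proof (intro sum.cong refl)
      fix u assume "u \<in> U"
      then have uk: "u k = 0" by (auto simp: U_def c_def)
      have "(\<Sum>y\<in>{y \<in> B. c y = u}. m k (y k) * W (c y)) = (\<Sum>y\<in>{y \<in> B. c y = u}. W u * m k (y k))"
        by (intro sum.cong) (auto simp: mult.commute)
      also have "\<dots> = (\<Sum>x\<in>{x. u(k := x) \<in> B}. W u * m k x)"
      proof (rule sum.reindex_bij_witness[of _ "\<lambda>x. u(k := x)" "\<lambda>y. y k"])
        fix y assume "y \<in> {y \<in> B. c y = u}"
        then show "u(k := y k) = y" "y k \<in> {x. u(k := x) \<in> B}" by (auto simp: c_def)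
      qed (use uk in \<open>auto simp: c_def\<close>)
      finally show "(\<Sum>y\<in>{y \<in> B. c y = u}. m k (y k) * W (c y)) = W u * P u"
        by (simp add: P_def sum_distrib_left)
    qed
    finally show ?thesis .
  qed
  \<comment> \<open>The induction hypothesis applies to each slice, because the sections of a slice
    in the remaining directions are sections of \<open>B\<close>.\<close>
  have "(\<Sum>y\<in>{y \<in> B. y k = v}. W (c y) * (\<Sum>j\<in>I. ln (\<Sum>x\<in>{x. y(j := x) \<in> B}. m j x))) \<le> q v * ln (q v)" for v
  proof -
    have "(\<Sum>u\<in>L v. W u * (\<Sum>j\<in>I. ln (\<Sum>x\<in>{x. u(j := x) \<in> L v}. m j x))) \<le> q v * ln (q v)"
      unfolding q_def W_def
    proof (rule insert.IH)
      show "finite (L v)" unfolding L_def using finB by auto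
      show "\<And>y j. y \<in> L v \<Longrightarrow> j \<notin> I \<Longrightarrow> y j = 0" using zero unfolding L_def c_def by auto
      show "\<And>j x. j \<in> I \<Longrightarrow> m j x > 0" using m by simp
    qed
    moreover have "{x. (c y)(j := x) \<in> L v} = {x. y(j := x) \<in> B}" if "j \<in> I" "y k = v" for j y
    proof -
      have jk: "j \<noteq> k" using that insert.hyps(2) by auto
      have "(c y)(j := x) \<in> L v \<longleftrightarrow> y(j := x) \<in> B" for x
      proof
        assume "(c y)(j := x) \<in> L v"
        then obtain z where z: "z \<in> B" "z k = v" "c z = (c y)(j := x)" by (auto simp: L_def)
        have "z = y(j := x)"
        proof
          fix i
          show "z i = (y(j := x)) i"
            using fun_cong[OF z(3), of i] z(2) that(2) jk by (auto simp: c_def split: if_splits)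
        qed
        then show "y(j := x) \<in> B" using z by simp
      next
        assume "y(j := x) \<in> B"
        moreover have "c (y(j := x)) = (c y)(j := x)" using jk by (auto simp: c_def fun_eq_iff)
        ultimately show "(c y)(j := x) \<in> L v" using that(2) jk unfolding L_def by (auto intro!: image_eqI[of _ _ "y(j := x)"])
      qed
      then show ?thesis by blast
    qed
    ultimately show ?thesis unfolding sumL by simp
  qed
  then have "(\<Sum>v\<in>V. m k v * (\<Sum>y\<in>{y \<in> B. y k = v}. W (c y) * (\<Sum>j\<in>I. ln (\<Sum>x\<in>{x. y(j := x) \<in> B}. m j x))))
      \<le> (\<Sum>v\<in>V. m k v * (q v * ln (q v)))"
    using m by (intro sum_mono mult_left_mono) (auto intro: less_imp_le)
  also have "\<dots> = (\<Sum>y\<in>B. m k (y k) * W (c y) * ln (q (y k)))"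
    unfolding sumV q_def sumL sum_distrib_left sum_distrib_right by (intro sum.cong) auto
  finally have A: "(\<Sum>y\<in>B. m k (y k) * W (c y) * (\<Sum>j\<in>I. ln (\<Sum>x\<in>{x. y(j := x) \<in> B}. m j x)))
      \<le> (\<Sum>y\<in>B. m k (y k) * W (c y) * ln (q (y k)))"
    unfolding sumV sum_distrib_left by (simp add: mult.assoc)
  \<comment> \<open>Nonnegativity of the mutual information between coordinate \<open>k\<close> and
    the others: by ln t \<le> t - 1 the left side is at most the mass that the product of the two
    marginals gives to \<open>B\<close>, minus \<open>S\<close>; the product has mass
    \<open>S\<close> in all.\<close>
  have C: "(\<Sum>y\<in>B. m k (y k) * W (c y) * (ln (P (c y)) + ln (q (y k)) - ln S)) \<le> 0"
  proof (cases "B = {}")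
    case False
    have Spos: "S > 0" unfolding S_def using False finB m Wpos by (intro sum_pos) auto
    have Ppos: "P (c y) > 0" if "y \<in> B" for y
      unfolding cP using finite_section[OF finB] m that by (intro sum_pos) (auto intro!: exI[of _ "y k"])
    have qpos: "q (y k) > 0" if "y \<in> B" for y
      unfolding q_def L_def using finB Wpos that by (intro sum_pos) auto
    have Pnn: "P u \<ge> 0" for u unfolding P_def using m by (intro sum_nonneg) (auto intro: less_imp_le)
    have qnn: "q v \<ge> 0" for v unfolding q_def using Wpos by (intro sum_nonneg) (auto intro: less_imp_le)
    have "(\<Sum>y\<in>B. m k (y k) * W (c y) * (ln (P (c y)) + ln (q (y k)) - ln S))
        \<le> (\<Sum>y\<in>B. m k (y k) * W (c y) * (P (c y) * q (y k) / S - 1))"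
    proof (intro sum_mono mult_left_mono)
      fix y assume y: "y \<in> B"
      have "ln (P (c y)) + ln (q (y k)) - ln S = ln (P (c y) * q (y k) / S)"
        using Ppos[OF y] qpos[OF y] Spos by (simp add: ln_mult ln_div)
      also have "\<dots> \<le> P (c y) * q (y k) / S - 1"
        using Ppos[OF y] qpos[OF y] Spos by (intro ln_le_minus_one) auto
      finally show "ln (P (c y)) + ln (q (y k)) - ln S \<le> P (c y) * q (y k) / S - 1" .
    qed (use m Wpos in \<open>auto intro!: mult_nonneg_nonneg less_imp_le\<close>)
    also have "\<dots> = (\<Sum>y\<in>B. m k (y k) * W (c y) * (P (c y) * q (y k))) / S - S"
      by (simp add: S_def algebra_simps sum_subtractf sum_divide_distrib)
    also have "(\<Sum>y\<in>B. m k (y k) * W (c y) * (P (c y) * q (y k))) =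
        (\<Sum>(u, v)\<in>(\<lambda>y. (c y, y k)) ` B. (W u * P u) * (m k v * q v))"
      by (subst sum.reindex) (auto intro!: inj_onI dest: c_inj simp: algebra_simps)
    also have "\<dots> \<le> (\<Sum>(u, v)\<in>U \<times> V. (W u * P u) * (m k v * q v))"
      using finB m Wpos Pnn qnn unfolding U_def V_def
      by (intro sum_mono2) (auto intro!: mult_nonneg_nonneg intro: less_imp_le)
    also have "\<dots> = S * S"
      unfolding sum.cartesian_product[symmetric] sum_product[symmetric] S_U[symmetric] S_V[symmetric] ..
    finally show ?thesis using Spos by (simp add: divide_right_mono)
  qed simp
  have "(\<Sum>y\<in>B. m k (y k) * W (c y) * (ln (P (c y)) + (\<Sum>j\<in>I. ln (\<Sum>x\<in>{x. y(j := x) \<in> B}. m j x))))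
      \<le> (\<Sum>y\<in>B. m k (y k) * W (c y) * (ln (P (c y)) + ln (q (y k))))"
    using A by (simp add: distrib_left sum.distrib)
  also have "\<dots> = (\<Sum>y\<in>B. m k (y k) * W (c y) * (ln (P (c y)) + ln (q (y k)) - ln S)) + S * ln S"
    unfolding S_def[symmetric] sum.distrib[symmetric] right_diff_distrib sum_subtractf
    by (simp add: S_def sum_distrib_right)
  also have "\<dots> \<le> S * ln S" using C by simp
  finally show ?case
    unfolding Wc S_def[symmetric] sum.insert[OF insert.hyps] cP .
qed

section \<open>Two roots\<close>

text \<open>After \<open>sum_shift\<close> both sides describe a root cycle of length l cut into a
  new root of length l - j and a cycle of length j. Reversing the roles of the pieces exchanges the
  sides, and \<open>sym\<close> says that \<open>B\<close> does not notice. So the root cycle and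
  the cycle of a second random point are exchangeable on \<open>B\<close>.\<close>

lemma sum_symmetric_shift:
  assumes sym: "\<And>y i j. y \<in> rooted_types n \<Longrightarrow> 1 \<le> i \<Longrightarrow> 1 \<le> j \<Longrightarrow> i + j = root_len n y \<Longrightarrow> add_cycle i y \<in> B \<Longrightarrow> add_cycle j y \<in> B"
  shows "(\<Sum>y\<in>rooted_types n. \<Sum>j\<in>{1..<n}. weight n y * real (j * y j) * (of_bool (y \<in> B) * G (root_len n y))) =
    (\<Sum>y\<in>rooted_types n. \<Sum>j\<in>{1..<n}. weight n y * real (j * y j) * (of_bool (y \<in> B) * (G j :: real)))"
  unfolding sum_shift[of n "\<lambda>y j. of_bool (y \<in> B) * G (root_len n y)"] sum_shift[of n "\<lambda>y j. of_bool (y \<in> B) * G j"]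
proof (rule sum.cong[OF refl])
  fix y assume y: "y \<in> rooted_types n"
  show "(\<Sum>j\<in>{1..<root_len n y}. weight n y * (of_bool (add_cycle j y \<in> B) * G (root_len n (add_cycle j y)))) =
        (\<Sum>j\<in>{1..<root_len n y}. weight n y * (of_bool (add_cycle j y \<in> B) * G j))"
  proof (rule sum.reindex_bij_witness[of _ "\<lambda>j. root_len n y - j" "\<lambda>j. root_len n y - j"])
    fix j assume j: "j \<in> {1..<root_len n y}"
    have "add_cycle (root_len n y - j) y \<in> B \<longleftrightarrow> add_cycle j y \<in> B"
      using sym[OF y, of j "root_len n y - j"] sym[OF y, of "root_len n y - j" j] j by auto
    then show "weight n y * (of_bool (add_cycle (root_len n y - j) y \<in> B) * G (root_len n y - j)) =
         weight n y * (of_bool (add_cycle j y \<in> B) * G (root_len n (add_cycle j y)))"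
      using add_cycle_rooted_types(2)[OF y, of j] j by (simp add: of_bool_def)
  qed auto
qed

text \<open>Of the n choices of a second point, \<open>root_len n y\<close> lie on the root cycle
  and \<open>j * y j\<close> on the \<open>j\<close>-cycles, so the left side is n^2 times the mean
  of \<psi> a * \<psi> c for the cycle lengths a, c of two points. The powers of the length that get
  summed are -1/2 and -3/4, both above -1; the two sums contribute 2 n^2 and (4 n)^2.\<close>

lemma second_root_moment:
  fixes n :: nat
  defines "\<psi> \<equiv> \<lambda>a :: nat. (real n / real a) powr (3/4)"
  shows "(\<Sum>y\<in>rooted_types n. weight n y * (real (root_len n y) * (\<psi> (root_len n y))\<^sup>2)) +
    (\<Sum>y\<in>rooted_types n. \<Sum>j\<in>{1..<n}. weight n y * real (j * y j) * (\<psi> (root_len n y) * \<psi> j)) \<le> 18 * (real n)\<^sup>2"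
proof -
  have nn: "\<psi> a \<ge> 0" for a by (simp add: \<psi>_def)
  have "(\<Sum>y\<in>rooted_types n. weight n y * (real (root_len n y) * (\<psi> (root_len n y))\<^sup>2)) =
      (\<Sum>l\<in>{1..n}. real l * (\<psi> l)\<^sup>2)"
    by (rule sum_weight_root_len)
  also have "\<dots> = (\<Sum>l\<in>{1..n}. real n * sqrt (real n) * (1 / sqrt (real l)))"
  proof (intro sum.cong refl)
    fix l assume l: "l \<in> {1..n}"
    define q where "q = real n / real l"
    have q: "q > 0" using l by (simp add: q_def)
    have "(\<psi> l)\<^sup>2 = q powr (1 + 1/2)"
      unfolding \<psi>_def q_def[symmetric] using q by (simp add: power2_eq_square powr_add[symmetric])
    also have "\<dots> = q * sqrt q" using q unfolding powr_add by (simp add: powr_half_sqrt)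
    finally show "real l * (\<psi> l)\<^sup>2 = real n * sqrt (real n) * (1 / sqrt (real l))"
      using l by (simp add: q_def real_sqrt_divide)
  qed
  also have "\<dots> \<le> real n * sqrt (real n) * (2 * sqrt (real n))"
    unfolding sum_distrib_left[symmetric] by (intro mult_left_mono sum_inverse_sqrt_le) auto
  also have "\<dots> = 2 * (real n)\<^sup>2" by (simp add: power2_eq_square)
  finally have 1: "(\<Sum>y\<in>rooted_types n. weight n y * (real (root_len n y) * (\<psi> (root_len n y))\<^sup>2)) \<le> 2 * (real n)\<^sup>2" .
  have "(\<Sum>y\<in>rooted_types n. \<Sum>j\<in>{1..<n}. weight n y * real (j * y j) * (\<psi> (root_len n y) * \<psi> j)) =
      (\<Sum>y\<in>rooted_types n. \<Sum>j\<in>{1..<root_len n y}. weight n y * (\<psi> (root_len n (add_cycle j y)) * \<psi> j))"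
    by (rule sum_shift)
  also have "\<dots> = (\<Sum>y\<in>rooted_types n. weight n y * (\<Sum>j\<in>{1..<root_len n y}. \<psi> (root_len n y - j) * \<psi> j))"
    unfolding sum_distrib_left by (intro sum.cong refl) (auto simp: add_cycle_rooted_types(2))
  also have "\<dots> = (\<Sum>l\<in>{1..n}. \<Sum>j\<in>{1..<l}. \<psi> (l - j) * \<psi> j)"
    by (rule sum_weight_root_len)
  also have "\<dots> = (\<Sum>(l, j)\<in>(SIGMA l:{1..n}. {1..<l}). \<psi> (l - j) * \<psi> j)"
    by (intro sum.Sigma) auto
  \<comment> \<open>The remaining root length a = l - j and the second length j become independent
    variables, and enlarging their range to a square makes the sum a product.\<close>
  also have "\<dots> = (\<Sum>(a, j)\<in>(\<lambda>(l, j). (l - j, j)) ` (SIGMA l:{1..n}. {1..<l}). \<psi> a * \<psi> j)"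
    by (subst sum.reindex) (auto simp: inj_on_def intro!: sum.cong)
  also have "\<dots> \<le> (\<Sum>(a, j)\<in>{1..n} \<times> {1..n}. \<psi> a * \<psi> j)"
    using nn by (intro sum_mono2) auto
  also have "\<dots> = (\<Sum>a\<in>{1..n}. \<psi> a) * (\<Sum>a\<in>{1..n}. \<psi> a)"
    by (simp add: sum.cartesian_product[symmetric] sum_product)
  also have "\<dots> \<le> (4 * real n) * (4 * real n)"
    using nn sum_powr_three_quarters_le[of n] unfolding \<psi>_def
    by (intro mult_mono) (auto intro: sum_nonneg)
  finally have "(\<Sum>y\<in>rooted_types n. \<Sum>j\<in>{1..<n}. weight n y * real (j * y j) * (\<psi> (root_len n y) * \<psi> j)) \<le> 16 * (real n)\<^sup>2"
    by (simp add: power2_eq_square)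
  with 1 show ?thesis by simp
qed

text \<open>
  The truncation \<open>off_root_size n y < n\<close> costs the mean of \<open>ln (n / root_len)\<close>. One root would only bound
  it by \<open>ln (n / S)\<close>, all of the available entropy; symmetry between two roots gains the factor \<open>2/3\<close>.
\<close>

lemma sum_ln_root_len_le:
  assumes n: "n > 0" and B: "B \<subseteq> rooted_types n" "B \<noteq> {}"
    and sym: "\<And>y i j. y \<in> rooted_types n \<Longrightarrow> 1 \<le> i \<Longrightarrow> 1 \<le> j \<Longrightarrow> i + j = root_len n y \<Longrightarrow> add_cycle i y \<in> B \<Longrightarrow> add_cycle j y \<in> B"
  defines "S \<equiv> \<Sum>y\<in>B. weight n y"
  shows "(\<Sum>y\<in>B. weight n y * ln (real n / real (root_len n y))) \<le> 2 / 3 * S * ln (18 * real n / S)"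
proof -
  define G where "G l = ln (real n / real l)" for l :: nat
  define \<psi> where "\<psi> a = (real n / real a) powr (3/4)" for a :: nat
  define K where "K = 18 * real n / S"
  have finB: "finite B" using B(1) finite_rooted_types by (rule finite_subset)
  have Spos: "S > 0" unfolding S_def using finB B(2) weight_pos by (intro sum_pos) auto
  have Kpos: "K > 0" using Spos n by (simp add: K_def)
  have on_B: "(\<Sum>y\<in>B. h y) = (\<Sum>y\<in>rooted_types n. of_bool (y \<in> B) * h y)" for h :: "_ \<Rightarrow> real"
    using B(1) by (intro sum.mono_neutral_cong_left finite_rooted_types) auto
  have tot: "real n = real l + (\<Sum>j\<in>{1..<n}. real (j * y j))" if "y \<in> rooted_types n" "l = root_len n y" for y l
  proof -
    have "real n = real (off_root_size n y) + real l" using root_len_rooted_types[OF that(1)] that(2) by linarith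
    then show ?thesis by (simp add: off_root_size_def)
  qed
  \<comment> \<open>Here \<open>p0 + q0 * x\<close> is 2/3 times the tangent of ln x at
    \<open>x = K\<close>, and 2/3 is the factor 1/2 of the symmetrisation divided by the exponent
    3/4.\<close>
  define p0 where "p0 = 2 / 3 * (ln K - 1)"
  define q0 where "q0 = 2 / (3 * K)"
  have q0: "q0 \<ge> 0" using Kpos by (simp add: q0_def)
  \<comment> \<open>The exponent in \<open>\<psi>\<close> must exceed \<open>1/2\<close> for the constant to come out below \<open>1\<close>, and be less than
    \<open>1\<close> for \<open>second_root_moment\<close>; \<open>K\<close> makes the additive constants cancel.\<close>
  have pair: "(G a + G c) / 2 \<le> p0 + q0 * (\<psi> a * \<psi> c)"
    if ac: "a \<in> {1..n}" "c \<in> {1..n}" for a c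
  proof -
    have pos: "\<psi> a > 0" "\<psi> c > 0" using ac by (auto simp: \<psi>_def)
    have "3 / 4 * (G a + G c) = ln (\<psi> a * \<psi> c)"
      using pos ac by (simp add: ln_mult G_def \<psi>_def ln_powr)
    also have "\<dots> = ln K + ln (\<psi> a * \<psi> c / K)" using pos Kpos by (simp add: ln_div)
    also have "\<dots> \<le> ln K + (\<psi> a * \<psi> c / K - 1)"
      using pos Kpos by (intro add_left_mono ln_le_minus_one) auto
    finally have "(G a + G c) / 2 \<le> 2 / 3 * (ln K - 1) + 2 / (3 * K) * (\<psi> a * \<psi> c)"
      by (simp add: field_simps)
    then show ?thesis by (simp add: p0_def q0_def)
  qed
  have wnn: "weight n y * real m \<ge> 0" for y m using weight_pos[of n y] by simp
  let ?b = "\<lambda>y. of_bool (y \<in> B) :: real"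
  \<comment> \<open>The weight n * \<open>weight n y\<close> is split by the position of the second
    point: \<open>D\<close> on the root cycle, \<open>E\<close> on a \<open>j\<close>-cycle.\<close>
  define D where "D y = weight n y * real (root_len n y)" for y
  define E where "E y j = weight n y * real (j * y j)" for y j
  have DE: "D y + (\<Sum>j\<in>{1..<n}. E y j) = real n * weight n y" if "y \<in> rooted_types n" for y
    unfolding D_def E_def sum_distrib_left[symmetric] distrib_left[symmetric]
    using tot[OF that refl] by (simp only: mult.commute)
  have DEnn: "D y \<ge> 0" "E y j \<ge> 0" for y j unfolding D_def E_def by (intro wnn)+
  have "real n * (\<Sum>y\<in>B. weight n y * G (root_len n y)) =
      (\<Sum>y\<in>rooted_types n. (D y + (\<Sum>j\<in>{1..<n}. E y j)) * (?b y * G (root_len n y)))"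
    unfolding on_B sum_distrib_left by (intro sum.cong refl) (simp add: DE[unfolded One_nat_def])
  also have "\<dots> = (\<Sum>y\<in>rooted_types n. D y * (?b y * G (root_len n y))) +
      (\<Sum>y\<in>rooted_types n. \<Sum>j\<in>{1..<n}. E y j * (?b y * G (root_len n y)))"
    by (simp add: distrib_right sum_distrib_right sum.distrib)
  also have "(\<Sum>y\<in>rooted_types n. \<Sum>j\<in>{1..<n}. E y j * (?b y * G (root_len n y))) =
      (\<Sum>y\<in>rooted_types n. \<Sum>j\<in>{1..<n}. E y j * (?b y * ((G (root_len n y) + G j) / 2)))"
  proof -
    have "(\<Sum>y\<in>rooted_types n. \<Sum>j\<in>{1..<n}. E y j * (?b y * G (root_len n y))) =
        (\<Sum>y\<in>rooted_types n. \<Sum>j\<in>{1..<n}. E y j * (?b y * G j))"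
      unfolding E_def by (rule sum_symmetric_shift[OF sym])
    then show ?thesis
      by (simp add: sum.distrib distrib_left add_divide_distrib sum_divide_distrib[symmetric])
  qed
  \<comment> \<open>Only the constant \<open>p0\<close> stays restricted to \<open>B\<close>. The
    nonnegative \<psi> part is summed over all types, so that the unconditional moment bound
    applies.\<close>
  also have "(\<Sum>y\<in>rooted_types n. D y * (?b y * G (root_len n y))) +
      (\<Sum>y\<in>rooted_types n. \<Sum>j\<in>{1..<n}. E y j * (?b y * ((G (root_len n y) + G j) / 2))) \<le>
    (\<Sum>y\<in>rooted_types n. D y * (?b y * p0 + q0 * (\<psi> (root_len n y))\<^sup>2)) +
    (\<Sum>y\<in>rooted_types n. \<Sum>j\<in>{1..<n}. E y j * (?b y * p0 + q0 * (\<psi> (root_len n y) * \<psi> j)))"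
  proof (intro add_mono sum_mono mult_left_mono DEnn)
    fix y assume "y \<in> rooted_types n"
    then have l: "root_len n y \<in> {1..n}" using root_len_rooted_types by blast
    show "?b y * G (root_len n y) \<le> ?b y * p0 + q0 * (\<psi> (root_len n y))\<^sup>2"
      using pair[OF l l] q0 by (auto simp: power2_eq_square)
    fix j assume "j \<in> {1..<n}"
    then have j: "j \<in> {1..n}" by auto
    show "?b y * ((G (root_len n y) + G j) / 2) \<le>
        ?b y * p0 + q0 * (\<psi> (root_len n y) * \<psi> j)"
      using pair[OF l j] q0 by (auto simp: \<psi>_def)
  qed
  also have "\<dots> = (\<Sum>y\<in>rooted_types n. (D y + (\<Sum>j\<in>{1..<n}. E y j)) * (?b y * p0)) +
      q0 * ((\<Sum>y\<in>rooted_types n. D y * (\<psi> (root_len n y))\<^sup>2) +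
        (\<Sum>y\<in>rooted_types n. \<Sum>j\<in>{1..<n}. E y j * (\<psi> (root_len n y) * \<psi> j)))"
    by (simp add: distrib_left distrib_right sum.distrib sum_distrib_left sum_distrib_right mult_ac)
  also have "(\<Sum>y\<in>rooted_types n. (D y + (\<Sum>j\<in>{1..<n}. E y j)) * (?b y * p0)) =
      real n * p0 * S"
    unfolding S_def on_B sum_distrib_left by (intro sum.cong refl) (simp add: DE[unfolded One_nat_def] mult_ac)
  also have "(\<Sum>y\<in>rooted_types n. D y * (\<psi> (root_len n y))\<^sup>2) +
        (\<Sum>y\<in>rooted_types n. \<Sum>j\<in>{1..<n}. E y j * (\<psi> (root_len n y) * \<psi> j)) \<le> 18 * (real n)\<^sup>2"
    using second_root_moment[of n] unfolding D_def E_def \<psi>_def by (simp add: mult.assoc)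
  also have "real n * p0 * S + q0 * (18 * (real n)\<^sup>2) = real n * (2 / 3 * S * ln K)"
    using Spos n by (simp add: p0_def q0_def K_def field_simps power2_eq_square)
  finally have "real n * (\<Sum>y\<in>B. weight n y * G (root_len n y)) \<le> real n * (2 / 3 * S * ln K)"
    using q0 by (simp add: mult_left_mono)
  then show ?thesis using n by (simp add: G_def K_def)
qed

section \<open>The isoperimetric inequality for rooted cycle types\<close>

definition cutoff :: "(nat \<Rightarrow> nat) set \<Rightarrow> nat \<Rightarrow> (nat \<Rightarrow> nat) \<Rightarrow> nat" where
  "cutoff B j y = (LEAST x. y(j := x) \<in> B)"

text \<open>
  \<open>excess\<close> bounds the logarithmic cost of a section (\<open>ln_section_le_excess\<close>). \<open>cutoff\<close> is only meaningful
  if the line through \<open>y\<close> in direction \<open>j\<close> meets \<open>B\<close>.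
\<close>

definition excess :: "nat \<Rightarrow> (nat \<Rightarrow> nat) set \<Rightarrow> nat \<Rightarrow> (nat \<Rightarrow> nat) \<Rightarrow> real" where
  "excess n B j y =
    (if cutoff B j y = 0 then of_bool (j < root_len n y \<and> y(j := 1) \<notin> B) / real j
     else ln (real j ^ cutoff B j y * fact (cutoff B j y)) + 1 / real j)"

section \<open>Mass and cost of a single section\<close>

lemma cutoff_upd [simp]: "cutoff B j (y(j := x)) = cutoff B j y"
  by (simp add: cutoff_def)

lemma cutoff_in: "y \<in> B \<Longrightarrow> y(j := cutoff B j y) \<in> B"
  unfolding cutoff_def by (rule LeastI[of _ "y j"]) simp

lemma cutoff_le: "y(j := x) \<in> B \<Longrightarrow> cutoff B j y \<le> x"
  unfolding cutoff_def by (rule Least_le)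

text \<open>Since m! (x - m)! \<le> x!, the terms from m on sum to at most e times the term at m,
  and e \<le> 3. Hence a section weighs at most three times its lowest possible point.\<close>

lemma sum_inverse_fact_le:
  assumes "finite X" and "\<And>x. x \<in> X \<Longrightarrow> m \<le> x" and "j \<ge> 1"
  shows "(\<Sum>x\<in>X. 1 / (real j ^ x * fact x)) \<le> 3 / (real j ^ m * fact m)"
proof -
  have "(\<Sum>x\<in>X. 1 / (real j ^ x * fact x)) \<le> (\<Sum>x\<in>X. 1 / (real j ^ m * fact m) * (1 / fact (x - m)))"
  proof (intro sum_mono)
    fix x assume "x \<in> X"
    then have x: "m \<le> x" using assms(2) by blast
    have "fact m * fact (x - m) * (x choose m) = fact x" using x by (rule binomial_fact_lemma)
    moreover have "1 \<le> x choose m" using x by (simp add: Suc_leI)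
    ultimately have "fact m * fact (x - m) \<le> (fact x :: nat)"
      by (metis mult.right_neutral mult_le_mono2)
    then have "real (fact m * fact (x - m)) \<le> real (fact x)" by (rule of_nat_mono)
    then have "fact m * fact (x - m) \<le> (fact x :: real)" by simp
    moreover have "real j ^ m \<le> real j ^ x" using x assms(3) by (intro power_increasing) auto
    ultimately have "real j ^ m * (fact m * fact (x - m)) \<le> real j ^ x * fact x"
      by (intro mult_mono) auto
    moreover have "0 < real j ^ m * (fact m * fact (x - m))" using assms(3) by simp
    ultimately have "1 / (real j ^ x * fact x) \<le> 1 / (real j ^ m * (fact m * fact (x - m)))"
      by (intro divide_left_mono mult_pos_pos) (use assms(3) in auto)
    then show "1 / (real j ^ x * fact x) \<le> 1 / (real j ^ m * fact m) * (1 / fact (x - m))"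
      by (simp add: mult.assoc)
  qed
  also have "\<dots> = 1 / (real j ^ m * fact m) * (\<Sum>i\<in>(\<lambda>x. x - m) ` X. 1 / fact i)"
    unfolding sum_distrib_left[symmetric]
    by (subst sum.reindex) (use assms(2) in \<open>auto intro!: inj_onI simp: eq_diff_iff\<close>)
  also have "\<dots> \<le> 1 / (real j ^ m * fact m) * 3"
  proof (intro mult_left_mono)
    have s: "(\<lambda>i. 1 / fact i :: real) sums exp 1"
      using exp_converges[of "1::real"] by (simp add: divide_inverse)
    have "(\<Sum>i\<in>(\<lambda>x. x - m) ` X. 1 / fact i :: real) \<le> exp 1"
      unfolding sums_unique[OF s] using sums_summable[OF s] assms(1) by (intro sum_le_suminf) auto
    then show "(\<Sum>i\<in>(\<lambda>x. x - m) ` X. 1 / fact i :: real) \<le> 3" using exp_le by simp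
  qed auto
  finally show ?thesis by simp
qed

lemma upd_zero_rooted_types:
  assumes "y \<in> rooted_types n"
  shows "y(j := 0) \<in> rooted_types n" "root_len n y \<le> root_len n (y(j := 0))"
proof -
  have "off_root_size n (y(j := 0)) \<le> off_root_size n y"
    unfolding off_root_size_def by (intro sum_mono) auto
  then show "y(j := 0) \<in> rooted_types n" "root_len n y \<le> root_len n (y(j := 0))"
    using assms by (auto simp: rooted_types_def root_len_def)
qed

lemma ln_fact_le: "ln (fact m) \<le> real m * ln (real m)"
proof (cases "m = 0")
  case False
  have "fact m \<le> real m ^ m"
    using fact_le_power[of m, where 'a=real] by simp
  then have "ln (fact m) \<le> ln (real m ^ m)"
    by (intro ln_mono) simp_all
  then show ?thesis using False by (simp add: ln_realpow)
qed simp

text \<open>The credit ln (1 + 1/j) is the logarithm of the mass of the values 0 and 1. A section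
  with both pays nothing, one that starts at 0 but lacks an available 1 pays 1/j, and one that
  starts higher is estimated by its lowest point alone.\<close>

lemma ln_section_le_excess:
  assumes B: "B \<subseteq> rooted_types n" and y: "y \<in> B" and j: "j \<in> {1..<n}"
  shows "- ln (\<Sum>x\<in>{x. y(j := x) \<in> B}. 1 / (real j ^ x * fact x)) +
    (if j < root_len n y then ln (1 + 1 / real j) else 0) \<le> excess n B j y"
proof -
  have finB: "finite B" using B finite_rooted_types by (rule finite_subset)
  let ?P = "\<Sum>x\<in>{x. y(j := x) \<in> B}. 1 / (real j ^ x * fact x)"
  have ge: "(\<Sum>x\<in>X. 1 / (real j ^ x * fact x)) \<le> ?P" if "X \<subseteq> {x. y(j := x) \<in> B}" for X
    using that finite_section[OF finB] by (intro sum_mono2) auto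
  have ln_le: "ln (1 + 1 / real j) \<le> 1 / real j" by (rule ln_add_one_self_le_self) simp
  show ?thesis
  proof (cases "cutoff B j y = 0")
    case True
    then have 0: "y(j := 0) \<in> B" using cutoff_in[OF y, of j] by simp
    have P1: "1 \<le> ?P" using ge[of "{0}"] 0 by simp
    show ?thesis
    proof (cases "j < root_len n y \<and> y(j := 1) \<in> B")
      case True
      have "1 + 1 / real j \<le> ?P" using ge[of "{0, 1}"] 0 True by simp
      then have "ln (1 + 1 / real j) \<le> ln ?P" using j by (intro ln_mono) (auto intro: add_pos_nonneg)
      then show ?thesis using True \<open>cutoff B j y = 0\<close> by (simp add: excess_def)
    next
      case False
      have "0 \<le> ln ?P" using P1 by simp
      then show ?thesis using False ln_le \<open>cutoff B j y = 0\<close> by (auto simp: excess_def)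
    qed
  next
    case False
    define G where "G = real j ^ cutoff B j y * fact (cutoff B j y)"
    have pos: "G > 0" using j by (simp add: G_def)
    have "1 / G \<le> ?P" using ge[of "{cutoff B j y}"] cutoff_in[OF y, of j] by (simp add: G_def)
    then have "ln (1 / G) \<le> ln ?P" using pos by (intro ln_mono) auto
    then have "- ln ?P \<le> ln G" using pos by (simp add: ln_div)
    moreover have "(if j < root_len n y then ln (1 + 1 / real j) else 0) \<le> 1 / real j"
      using ln_le by simp
    ultimately show ?thesis using False by (simp add: excess_def G_def)
  qed
qed

text \<open>The crude factor \<open>j * m\<close> is affordable: by \<open>weight_add_cycle\<close>
  it is the ratio of the weights at the values m - 1 and m, hence of the crossing edge to the lowest
  point of the section.\<close>

lemma excess_le:
  assumes j: "j \<ge> 1" and m: "m = cutoff B j y" "1 \<le> m" "m \<le> M"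
  shows "excess n B j y \<le> real (j * m) * (2 + ln (real M))"
proof -
  have jm: "real j \<ge> 1" "real m \<ge> 1" using j m by auto
  have "excess n B j y = real m * ln (real j) + ln (fact m) + 1 / real j"
    using m j by (simp add: excess_def ln_mult ln_realpow)
  also have "\<dots> \<le> real m * real j + real j * (real m * ln (real M)) + real m * real j"
  proof (intro add_mono)
    have "ln (real j) \<le> real j" using ln_le_minus_one[of "real j"] jm by simp
    then show "real m * ln (real j) \<le> real m * real j" by (intro mult_left_mono) auto
    have "ln (fact m) \<le> real m * ln (real m)" by (rule ln_fact_le)
    also have "\<dots> \<le> real m * ln (real M)" using m by (intro mult_left_mono ln_mono) auto
    also have "\<dots> \<le> real j * (real m * ln (real M))"
      using jm m mult_right_mono[of 1 "real j" "real m * ln (real M)"] by simp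
    finally show "ln (fact m) \<le> real j * (real m * ln (real M))" .
    have "1 / real j \<le> 1" using jm by simp
    also have "1 \<le> real m * real j" using mult_mono[of 1 "real m" 1 "real j"] jm by simp
    finally show "1 / real j \<le> real m * real j" .
  qed
  finally show ?thesis by (simp add: algebra_simps)
qed

text \<open>The inequality holds on each line in direction \<open>j\<close>, named by its point
  \<open>u\<close> with value 0. One crossing edge pays for the line: the edge below the cutoff, or
  the edge from 0 to 1 if the section starts at 0 and lacks an available 1. The factor 3 is that of
  \<open>sum_inverse_fact_le\<close>.\<close>

lemma sum_excess_small:
  assumes B: "B \<subseteq> rooted_types n" and j: "j \<in> {1..<n}" and M: "M \<ge> 1"
  shows "(\<Sum>y\<in>{y \<in> B. cutoff B j y \<le> M}. weight n y * excess n B j y) \<le>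
    3 * (2 + ln (real M)) * (\<Sum>v\<in>rooted_types n. weight n v * of_bool (j < root_len n v \<and> (v \<in> B) \<noteq> (add_cycle j v \<in> B)))"
proof -
  have finB: "finite B" using B finite_rooted_types by (rule finite_subset)
  define c where "c y = y(j := 0)" for y :: "nat \<Rightarrow> nat"
  define Y where "Y = {y \<in> B. cutoff B j y \<le> M}"
  define h where "h v = weight n v * of_bool (j < root_len n v \<and> (v \<in> B) \<noteq> (add_cycle j v \<in> B))" for v
  have hnn: "h v \<ge> 0" for v using weight_pos[of n v] by (simp add: h_def)
  let ?K = "3 * (2 + ln (real M))"
  have K: "?K \<ge> 3" using M by simp
  have "(\<Sum>y\<in>{y \<in> Y. c y = u}. weight n y * excess n B j y) \<le> ?K * (\<Sum>v\<in>{v \<in> rooted_types n. c v = u}. h v)"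
    if "u \<in> c ` rooted_types n" for u
  proof (cases "{y \<in> Y. c y = u} = {}")
    case True
    then show ?thesis using K hnn by (simp only: sum.empty) (intro mult_nonneg_nonneg sum_nonneg; simp)
  next
    case False
    then obtain z where z: "z \<in> B" "cutoff B j z \<le> M" "c z = u" by (auto simp: Y_def)
    define m where "m = cutoff B j z"
    define X where "X = (\<lambda>y. y j) ` {y \<in> Y. c y = u}"
    have yu: "y = u(j := y j)" if "c y = u" for y using that by (auto simp: c_def)
    have cut: "cutoff B j y = m" if "c y = u" for y
      using that z(3) cutoff_upd[of B j y 0] cutoff_upd[of B j z 0] by (simp add: c_def m_def)
    have u: "u = c u" using z(3) by (auto simp: c_def)
    have um: "u(j := m) \<in> B" using cutoff_in[OF z(1), of j] z(3) by (auto simp: c_def m_def)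
    have Xm: "m \<le> x" if xX: "x \<in> X" for x
    proof -
      obtain y where "y \<in> B" "c y = u" "x = y j" using xX by (auto simp: X_def Y_def)
      then show ?thesis using cutoff_le[of y j x B] cut by simp
    qed
    have finX: "finite X" unfolding X_def Y_def using finB by auto
    have bound: "(\<Sum>y\<in>{y \<in> Y. c y = u}. weight n y * excess n B j y) \<le> 3 * weight n u / (real j ^ m * fact m) * t"
      if t: "\<And>y. y \<in> Y \<Longrightarrow> c y = u \<Longrightarrow> excess n B j y \<le> t" "t \<ge> 0" for t
    proof -
      have "(\<Sum>y\<in>{y \<in> Y. c y = u}. weight n y * excess n B j y) \<le>
          (\<Sum>y\<in>{y \<in> Y. c y = u}. weight n u * t * (1 / (real j ^ y j * fact (y j))))"
      proof (intro sum_mono)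
        fix y assume y: "y \<in> {y \<in> Y. c y = u}"
        have "weight n y = weight n u * (1 / (real j ^ y j * fact (y j)))"
          using weight_upd[OF j, of y "y j"] y by (simp add: c_def)
        moreover have "weight n y * excess n B j y \<le> weight n y * t"
          using t(1) y weight_pos[of n y] by (intro mult_left_mono) auto
        ultimately show "weight n y * excess n B j y \<le> weight n u * t * (1 / (real j ^ y j * fact (y j)))"
          by (simp add: mult_ac)
      qed
      also have "\<dots> = weight n u * t * (\<Sum>x\<in>X. 1 / (real j ^ x * fact x))"
      proof -
        have "inj_on (\<lambda>y. y j) {y \<in> Y. c y = u}"
          by (rule inj_onI) (metis (mono_tags, lifting) mem_Collect_eq yu)
        then show ?thesis unfolding sum_distrib_left[symmetric] X_def by (simp add: sum.reindex)
      qed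
      also have "\<dots> \<le> weight n u * t * (3 / (real j ^ m * fact m))"
        using weight_pos[of n u] t(2) j by (intro mult_left_mono sum_inverse_fact_le finX Xm) auto
      finally show ?thesis by (simp add: mult_ac)
    qed
    have one: "weight n v \<le> (\<Sum>v\<in>{v \<in> rooted_types n. c v = u}. h v)"
      if "v \<in> rooted_types n" "c v = u" "j < root_len n v" "(v \<in> B) \<noteq> (add_cycle j v \<in> B)" for v
    proof -
      have "h v \<le> (\<Sum>v\<in>{v \<in> rooted_types n. c v = u}. h v)"
        using that hnn finite_rooted_types by (intro member_le_sum) auto
      then show ?thesis using that by (simp add: h_def)
    qed
    show ?thesis
    proof (cases "m = 0")
      case True
      have uB: "u \<in> B" using um True u by (simp add: c_def)
      show ?thesis
      proof (cases "j < root_len n u \<and> u(j := 1) \<notin> B")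
        case t: True
        have "(\<Sum>y\<in>{y \<in> Y. c y = u}. weight n y * excess n B j y) \<le> 3 * weight n u / (real j ^ m * fact m) * 1"
          by (rule bound) (use j cut True in \<open>auto simp: excess_def of_bool_def\<close>)
        also have "\<dots> = 3 * weight n u" using True by simp
        also have "\<dots> \<le> ?K * (\<Sum>v\<in>{v \<in> rooted_types n. c v = u}. h v)"
        proof (intro mult_mono K one)
          have "u j = 0" using fun_cong[OF u, of j] by (simp add: c_def)
          then show "(u \<in> B) \<noteq> (add_cycle j u \<in> B)" using t uB by (simp add: add_cycle_def)
        qed (use uB B u t K weight_pos[of n u] in auto)
        finally show ?thesis .
      next
        case f: False
        have "(\<Sum>y\<in>{y \<in> Y. c y = u}. weight n y * excess n B j y) \<le> 3 * weight n u / (real j ^ m * fact m) * 0"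
        proof (rule bound)
          fix y assume y: "y \<in> Y" "c y = u"
          then have yp: "y \<in> rooted_types n" using B by (auto simp: Y_def)
          have "root_len n y \<le> root_len n u" using upd_zero_rooted_types(2)[OF yp, of j] y(2) by (simp add: c_def)
          moreover have "y(j := 1) = u(j := 1)" using y(2) by (auto simp: c_def)
          ultimately show "excess n B j y \<le> 0" using cut[OF y(2)] True f by (auto simp: excess_def)
        qed simp
        also have "\<dots> \<le> ?K * (\<Sum>v\<in>{v \<in> rooted_types n. c v = u}. h v)"
          using K hnn by (simp only: mult_zero_right) (intro mult_nonneg_nonneg sum_nonneg; simp)
        finally show ?thesis .
      qed
    next
      case False
      \<comment> \<open>The point just below the lowest point of the section, hence outside
        \<open>B\<close>; the edge leaving it upwards crosses.\<close>
      define v where "v = u(j := m - 1)"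
      have up: "u(j := m) \<in> rooted_types n" using um B by blast
      have d: "v \<in> rooted_types n" "add_cycle j v = u(j := m)" "j < root_len n v"
        using decr_rooted_types(1,2,4)[OF up, of j] False by (auto simp: v_def)
      have vB: "v \<notin> B"
      proof
        assume "v \<in> B"
        then have "z(j := m - 1) \<in> B" using z(3) by (auto simp: v_def c_def)
        then show False using cutoff_le[of z j "m - 1" B] False by (simp add: m_def)
      qed
      have "weight n v = weight n (u(j := m)) * real (j * m)"
        using weight_add_cycle[OF j, of v] d(2) False by (simp add: v_def)
      moreover have "weight n (u(j := m)) = weight n u / (real j ^ m * fact m)"
        using weight_upd[OF j, of u m] u by (simp add: c_def)
      ultimately have Wv: "weight n v = weight n u / (real j ^ m * fact m) * real (j * m)" by simp
      have "(\<Sum>y\<in>{y \<in> Y. c y = u}. weight n y * excess n B j y) \<le>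
          3 * weight n u / (real j ^ m * fact m) * (real (j * m) * (2 + ln (real M)))"
      proof (rule bound)
        fix y assume y: "y \<in> Y" "c y = u"
        show "excess n B j y \<le> real (j * m) * (2 + ln (real M))"
          by (rule excess_le) (use j False cut[OF y(2)] z(2) in \<open>auto simp: m_def\<close>)
      qed (use M in auto)
      also have "\<dots> = ?K * weight n v" unfolding Wv by (simp add: mult_ac)
      also have "\<dots> \<le> ?K * (\<Sum>v\<in>{v \<in> rooted_types n. c v = u}. h v)"
        by (intro mult_left_mono one) (use d um vB u K in \<open>auto simp: v_def c_def\<close>)
      finally show ?thesis .
    qed
  qed
  then have "(\<Sum>u\<in>c ` rooted_types n. \<Sum>y\<in>{y \<in> Y. c y = u}. weight n y * excess n B j y) \<le>
      (\<Sum>u\<in>c ` rooted_types n. ?K * (\<Sum>v\<in>{v \<in> rooted_types n. c v = u}. h v))"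
    by (rule sum_mono)
  moreover have "(\<Sum>u\<in>c ` rooted_types n. \<Sum>y\<in>{y \<in> Y. c y = u}. weight n y * excess n B j y) =
      (\<Sum>y\<in>Y. weight n y * excess n B j y)"
    by (rule sum.group) (use B finB finite_rooted_types in \<open>auto simp: Y_def\<close>)
  moreover have "(\<Sum>u\<in>c ` rooted_types n. (\<Sum>v\<in>{v \<in> rooted_types n. c v = u}. h v)) = (\<Sum>v\<in>rooted_types n. h v)"
    by (rule sum.group) (use finite_rooted_types in auto)
  ultimately show ?thesis unfolding Y_def h_def sum_distrib_left[symmetric] by simp
qed

text \<open>No boundary is involved, only the rarity of large counts. With g x = j^x x! the excess
  is at most 2 sqrt (g (y j)), while the weight carries the factor 1 / g (y j), so half of the decay
  survives.\<close>

lemma sum_excess_tail: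
  assumes B: "B \<subseteq> rooted_types n" and j: "j \<in> {1..<n}"
  shows "(\<Sum>y\<in>{y \<in> B. M < cutoff B j y}. weight n y * excess n B j y) \<le>
    (\<Sum>x\<in>{M<..n}. 2 * real n / sqrt (real j ^ x * fact x))"
proof -
  have finB: "finite B" using B finite_rooted_types by (rule finite_subset)
  define g where "g x = real j ^ x * fact x" for x
  have g: "g x \<ge> 1" for x
    using mult_mono[of 1 "real j ^ x" 1 "fact x"] j fact_ge_1[of x, where 'a=real] by (simp add: g_def)
  have gmono: "g m \<le> g x" if "m \<le> x" for m x
    unfolding g_def using that j by (intro mult_mono power_increasing fact_mono) auto
  have cle: "cutoff B j y \<le> y j" if "y \<in> B" for y using cutoff_le[of y j "y j" B] that by simp
  define Y where "Y = {y \<in> rooted_types n. M < y j}"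
  have ne: "2 * weight n (y(j := 0)) / sqrt (g (y j)) \<ge> 0" for y
    using weight_pos[of n "y(j := 0)"] g[of "y j"] by simp
  have "(\<Sum>y\<in>{y \<in> B. M < cutoff B j y}. weight n y * excess n B j y) \<le>
      (\<Sum>y\<in>{y \<in> B. M < cutoff B j y}. 2 * weight n (y(j := 0)) / sqrt (g (y j)))"
  proof (intro sum_mono)
    fix y assume y: "y \<in> {y \<in> B. M < cutoff B j y}"
    define s where "s = sqrt (g (y j))"
    have s: "s \<ge> 1" "g (y j) = s * s" using g[of "y j"] by (auto simp: s_def)
    have Wy: "weight n y = weight n (y(j := 0)) / (s * s)"
      using weight_upd[OF j, of y "y j"] s(2) by (simp add: g_def)
    have "excess n B j y = ln (g (cutoff B j y)) + 1 / real j" using y by (auto simp: excess_def g_def)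
    also have "\<dots> \<le> ln (g (y j)) + 1"
    proof (intro add_mono)
      show "ln (g (cutoff B j y)) \<le> ln (g (y j))"
        using gmono[OF cle, of y] y g[of "cutoff B j y"] by (intro ln_mono) auto
    qed (use j in auto)
    also have "ln (g (y j)) = 2 * ln s" using s by (simp add: ln_mult)
    also have "2 * ln s + 1 \<le> 2 * s" using ln_le_minus_one[of s] s by simp
    finally have "excess n B j y \<le> 2 * s" .
    then have "weight n y * excess n B j y \<le> weight n y * (2 * s)"
      using weight_pos[of n y] by (intro mult_left_mono) auto
    also have "\<dots> = 2 * weight n (y(j := 0)) / s" unfolding Wy using s(1) by simp
    finally show "weight n y * excess n B j y \<le> 2 * weight n (y(j := 0)) / sqrt (g (y j))" by (simp add: s_def)
  qed
  also have "\<dots> \<le> (\<Sum>y\<in>Y. 2 * weight n (y(j := 0)) / sqrt (g (y j)))"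
  proof (rule sum_mono2)
    show "{y \<in> B. M < cutoff B j y} \<subseteq> Y" using B cle by (force simp: Y_def)
  qed (use ne finite_rooted_types in \<open>auto simp: Y_def\<close>)
  also have "\<dots> = (\<Sum>x\<in>{M<..n}. \<Sum>y\<in>{y \<in> Y. y j = x}. 2 * weight n (y(j := 0)) / sqrt (g (y j)))"
    using rooted_types_le finite_rooted_types by (intro sum.group[symmetric]) (auto simp: Y_def)
  also have "\<dots> \<le> (\<Sum>x\<in>{M<..n}. 2 * real n / sqrt (g x))"
  proof (intro sum_mono)
    fix x
    \<comment> \<open>For fixed \<open>x\<close>, erasing the coordinate is injective, so the erased
      weights sum to at most the total mass \<open>n\<close>.\<close>
    have inj: "inj_on (\<lambda>y. y(j := 0)) {y \<in> Y. y j = x}"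
      by (rule inj_onI) (metis (mono_tags, lifting) fun_upd_triv fun_upd_upd mem_Collect_eq)
    have "(\<Sum>y\<in>{y \<in> Y. y j = x}. weight n (y(j := 0))) = (\<Sum>u\<in>(\<lambda>y. y(j := 0)) ` {y \<in> Y. y j = x}. weight n u)"
      by (simp add: sum.reindex[OF inj])
    also have "\<dots> \<le> (\<Sum>u\<in>rooted_types n. weight n u)"
      using upd_zero_rooted_types(1) finite_rooted_types weight_pos by (intro sum_mono2) (auto simp: Y_def intro: less_imp_le)
    also have "\<dots> = real n" by (rule sum_weight)
    finally have "2 / sqrt (g x) * (\<Sum>y\<in>{y \<in> Y. y j = x}. weight n (y(j := 0))) \<le> 2 / sqrt (g x) * real n"
      using g[of x] by (intro mult_left_mono) auto
    then show "(\<Sum>y\<in>{y \<in> Y. y j = x}. 2 * weight n (y(j := 0)) / sqrt (g (y j))) \<le> 2 * real n / sqrt (g x)"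
      by (simp add: sum_distrib_left)
  qed
  finally show ?thesis by (simp add: g_def)
qed

section \<open>The tail beyond the cutoff M\<close>

lemma sum_inverse_squares_le: "(\<Sum>j\<in>{1..<n}. 1 / (real j)\<^sup>2) \<le> 2"
proof -
  have *: "(\<Sum>j\<in>{1..<Suc (Suc m)}. 1 / (real j)\<^sup>2) \<le> 2 - 1 / real (Suc m)" for m
  proof (induction m)
    case (Suc m)
    define a where "a = real (Suc m)"
    have a: "a > 0" by (simp add: a_def)
    have "1 / (a + 1)\<^sup>2 \<le> 1 / (a * (a + 1))"
      unfolding power2_eq_square using a by (intro divide_left_mono mult_right_mono mult_pos_pos) auto
    also have "\<dots> = 1 / a - 1 / (a + 1)" using a by (simp add: field_simps)
    finally have "1 / (real (Suc (Suc m)))\<^sup>2 \<le> 1 / real (Suc m) - 1 / real (Suc (Suc m))"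
      by (simp add: a_def add.commute)
    moreover have "(\<Sum>j\<in>{1..<Suc (Suc (Suc m))}. 1 / (real j)\<^sup>2) =
        (\<Sum>j\<in>{1..<Suc (Suc m)}. 1 / (real j)\<^sup>2) + 1 / (real (Suc (Suc m)))\<^sup>2"
      by (rule sum.atLeastLessThan_Suc) simp
    ultimately show ?case using Suc by linarith
  qed simp
  show ?thesis
  proof (cases "n \<le> 1")
    case False
    then obtain m where m: "n = Suc (Suc m)" by (metis One_nat_def le_SucI le_zero_eq not0_implies_Suc order_refl)
    have "0 \<le> 1 / real (Suc m)" by simp
    then show ?thesis unfolding m using *[of m] by linarith
  qed simp
qed

text \<open>\<open>M \<ge> 3\<close> forces x \<ge> 4. Then sqrt (j^x) \<ge> j^2 makes the sum over
  \<open>j\<close> converge, and sqrt (x!) \<ge> 2^x / 4 makes the sum over \<open>x\<close>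
  geometric.\<close>

lemma sum_tail_le:
  assumes M: "M \<ge> 3"
  shows "(\<Sum>j\<in>{1..<n}. \<Sum>x\<in>{M<..n}. 2 * real n / sqrt (real j ^ x * fact x)) \<le> 16 * real n / 2 ^ M"
proof -
  have fact_ge: "4 ^ x \<le> 16 * (fact x :: real)" if "x \<ge> 4" for x :: nat
    using that
  proof (induction x rule: dec_induct)
    case (step x)
    have "(4 :: real) ^ Suc x \<le> real (Suc x) * (16 * fact x)"
      using step by (simp only: power_Suc) (intro mult_mono; simp)
    then show ?case by (simp add: algebra_simps)
  qed (simp add: fact_numeral)
  have term_le: "2 * real n / sqrt (real j ^ x * fact x) \<le> (8 * real n) * (1 / (real j)\<^sup>2) * (1 / 2) ^ x"
    if j: "j \<in> {1..<n}" and x: "x \<in> {M<..n}" for j x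
  proof -
    have x4: "x \<ge> 4" using x M by simp
    have j1: "real j \<ge> 1" using j by simp
    have "((real j)\<^sup>2 * 2 ^ x / 4)\<^sup>2 = real j ^ 4 * (4 ^ x / 16)"
    proof -
      have "(4 :: real) ^ x = 2 ^ x * 2 ^ x" by (simp flip: power_mult_distrib)
      then show ?thesis by (simp add: power2_eq_square power4_eq_xxxx)
    qed
    also have "\<dots> \<le> real j ^ x * fact x"
      using fact_ge[OF x4] x4 j1 by (intro mult_mono power_increasing) auto
    finally have "(real j)\<^sup>2 * 2 ^ x / 4 \<le> sqrt (real j ^ x * fact x)"
      by (rule real_le_rsqrt)
    then have "2 * real n / sqrt (real j ^ x * fact x) \<le> 2 * real n / ((real j)\<^sup>2 * 2 ^ x / 4)"
      using j1 j by (intro divide_left_mono mult_pos_pos) auto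
    also have "\<dots> = (8 * real n) * (1 / (real j)\<^sup>2) * (1 / 2) ^ x"
      by (simp add: power_divide)
    finally show ?thesis .
  qed
  have geo: "(\<Sum>x\<in>{M<..n}. (1 / 2) ^ x :: real) \<le> 1 / 2 ^ M"
  proof -
    have "(\<Sum>x\<in>{M<..n}. (1 / 2) ^ x :: real) \<le> (1 / 2) ^ M - (1 / 2) ^ (max M n)"
    proof (induction n)
      case (Suc n)
      show ?case
      proof (cases "M \<le> n")
        case True
        then have "{M<..Suc n} = insert (Suc n) {M<..n}" by auto
        then show ?thesis using Suc True by (simp add: max_def)
      qed (simp add: max_def)
    qed simp
    also have "\<dots> \<le> 1 / 2 ^ M" by (simp add: power_divide)
    finally show ?thesis .
  qed
  have "(\<Sum>j\<in>{1..<n}. \<Sum>x\<in>{M<..n}. 2 * real n / sqrt (real j ^ x * fact x)) \<le>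
      (\<Sum>j\<in>{1..<n}. \<Sum>x\<in>{M<..n}. (8 * real n) * (1 / (real j)\<^sup>2) * (1 / 2) ^ x)"
    by (intro sum_mono term_le)
  also have "\<dots> = (8 * real n) * (\<Sum>j\<in>{1..<n}. 1 / (real j)\<^sup>2) * (\<Sum>x\<in>{M<..n}. (1 / 2) ^ x)"
    by (simp add: sum_distrib_left sum_distrib_right) (rule sum.swap)
  also have "\<dots> \<le> (8 * real n) * 2 * (1 / 2 ^ M)"
    using sum_inverse_squares_le[of n] by (intro mult_mono geo) (auto intro!: sum_nonneg)
  finally show ?thesis by simp
qed

text \<open>With l the root length, ln (n / S) splits into ln (n / l), whose mean is bounded by
  \<open>sum_ln_root_len_le\<close>, and ln l - ln S, which subadditivity compares with the sections
  and hence with the excess. Excess at cutoffs up to \<open>M\<close> is charged to the boundary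
  \<beta>, beyond \<open>M\<close> to the tail.\<close>

lemma entropy_inequality:
  assumes n: "n > 0" and B: "B \<subseteq> rooted_types n" "B \<noteq> {}" and M: "M \<ge> 3"
    and sym: "\<And>y i j. y \<in> rooted_types n \<Longrightarrow> 1 \<le> i \<Longrightarrow> 1 \<le> j \<Longrightarrow> i + j = root_len n y \<Longrightarrow> add_cycle i y \<in> B \<Longrightarrow> add_cycle j y \<in> B"
  defines "S \<equiv> \<Sum>y\<in>B. weight n y"
    and "\<beta> \<equiv> \<Sum>y\<in>rooted_types n. weight n y * real (card {j \<in> {1..<root_len n y}. (y \<in> B) \<noteq> (add_cycle j y \<in> B)})"
  shows "S * ln (real n / S) \<le> 2 / 3 * S * ln (18 * real n / S) + 3 * (2 + ln (real M)) * \<beta> + 16 * real n / 2 ^ M"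
proof -
  have finB: "finite B" using B(1) finite_rooted_types by (rule finite_subset)
  have Spos: "S > 0" unfolding S_def using finB B(2) weight_pos by (intro sum_pos) auto
  define P where "P y j = (\<Sum>x\<in>{x. y(j := x) \<in> B}. 1 / (real j ^ x * fact x))" for y j
  have A: "(\<Sum>y\<in>B. weight n y * (\<Sum>j\<in>{1..<n}. ln (P y j))) \<le> S * ln S"
    unfolding S_def P_def weight_def
    by (rule sum_ln_sections_le) (use finB B(1) in \<open>auto simp: rooted_types_def\<close>)
  have pt: "ln (real (root_len n y)) - (\<Sum>j\<in>{1..<n}. ln (P y j)) \<le> (\<Sum>j\<in>{1..<n}. excess n B j y)"
    if y: "y \<in> B" for y
  proof -
    let ?l = "root_len n y"
    have l: "?l \<in> {1..n}" using root_len_rooted_types y B(1) by blast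
    \<comment> \<open>The product of the factors 1 + 1/j over j < l telescopes to l exactly, so
      these credits leave no additive error.\<close>
    have "(\<Sum>j\<in>{1..<Suc m}. ln (1 + 1 / real j)) = ln (real (Suc m))" for m
    proof (induction m)
      case (Suc m)
      have "1 + 1 / real (Suc m) = real (Suc (Suc m)) / real (Suc m)" by (simp add: field_simps)
      then have "ln (1 + 1 / real (Suc m)) = ln (real (Suc (Suc m))) - ln (real (Suc m))"
        using ln_div[of "real (Suc (Suc m))" "real (Suc m)"] by (simp only:) simp
      then show ?case using Suc by simp
    qed simp
    moreover have "Suc (?l - 1) = ?l" using l by simp
    ultimately have "ln (real ?l) = (\<Sum>j\<in>{1..<?l}. ln (1 + 1 / real j))"
      by metis
    also have "\<dots> = (\<Sum>j\<in>{1..<n}. if j < ?l then ln (1 + 1 / real j) else 0)"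
      using l by (intro sum.mono_neutral_cong_left) auto
    finally have "ln (real ?l) - (\<Sum>j\<in>{1..<n}. ln (P y j)) =
        (\<Sum>j\<in>{1..<n}. - ln (P y j) + (if j < ?l then ln (1 + 1 / real j) else 0))"
      unfolding sum.distrib sum_negf by simp
    also have "\<dots> \<le> (\<Sum>j\<in>{1..<n}. excess n B j y)"
      unfolding P_def by (intro sum_mono ln_section_le_excess B(1) y)
    finally show ?thesis .
  qed
  have "(\<Sum>y\<in>B. weight n y * (ln (real (root_len n y)) - (\<Sum>j\<in>{1..<n}. ln (P y j)))) \<le>
      (\<Sum>y\<in>B. weight n y * (\<Sum>j\<in>{1..<n}. excess n B j y))"
    using weight_pos by (intro sum_mono mult_left_mono pt) (auto intro: less_imp_le)
  also have "\<dots> = (\<Sum>j\<in>{1..<n}. \<Sum>y\<in>B. weight n y * excess n B j y)"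
    unfolding sum_distrib_left by (rule sum.swap)
  also have "\<dots> = (\<Sum>j\<in>{1..<n}. (\<Sum>y\<in>{y \<in> B. cutoff B j y \<le> M}. weight n y * excess n B j y) +
      (\<Sum>y\<in>{y \<in> B. M < cutoff B j y}. weight n y * excess n B j y))"
  proof (intro sum.cong refl)
    fix j
    have "{y \<in> B. cutoff B j y \<le> M} \<union> {y \<in> B. M < cutoff B j y} = B" by auto
    then show "(\<Sum>y\<in>B. weight n y * excess n B j y) = (\<Sum>y\<in>{y \<in> B. cutoff B j y \<le> M}. weight n y * excess n B j y) +
      (\<Sum>y\<in>{y \<in> B. M < cutoff B j y}. weight n y * excess n B j y)"
      using finB by (subst sum.union_disjoint[symmetric]) auto
  qed
  also have "\<dots> \<le> (\<Sum>j\<in>{1..<n}. 3 * (2 + ln (real M)) *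
        (\<Sum>v\<in>rooted_types n. weight n v * of_bool (j < root_len n v \<and> (v \<in> B) \<noteq> (add_cycle j v \<in> B))) +
      (\<Sum>x\<in>{M<..n}. 2 * real n / sqrt (real j ^ x * fact x)))"
    using M by (intro sum_mono add_mono sum_excess_small sum_excess_tail B(1)) auto
  also have "\<dots> = 3 * (2 + ln (real M)) *
        (\<Sum>j\<in>{1..<n}. \<Sum>v\<in>rooted_types n. weight n v * of_bool (j < root_len n v \<and> (v \<in> B) \<noteq> (add_cycle j v \<in> B))) +
      (\<Sum>j\<in>{1..<n}. \<Sum>x\<in>{M<..n}. 2 * real n / sqrt (real j ^ x * fact x))"
    by (simp only: sum.distrib sum_distrib_left[symmetric])
  also have "(\<Sum>j\<in>{1..<n}. \<Sum>v\<in>rooted_types n. weight n v * of_bool (j < root_len n v \<and> (v \<in> B) \<noteq> (add_cycle j v \<in> B))) =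
      (\<Sum>v\<in>rooted_types n. weight n v * (\<Sum>j\<in>{1..<n}. of_bool (j < root_len n v \<and> (v \<in> B) \<noteq> (add_cycle j v \<in> B))))"
    unfolding sum_distrib_left by (rule sum.swap)
  also have "\<dots> = \<beta>"
    unfolding \<beta>_def
  proof (intro sum.cong refl arg_cong2[of _ _ _ _ "(*)"])
    fix v
    have "{1..<n} \<inter> {j. j < root_len n v \<and> (v \<in> B) \<noteq> (add_cycle j v \<in> B)} =
        {j \<in> {1..<root_len n v}. (v \<in> B) \<noteq> (add_cycle j v \<in> B)}"
      by (auto simp: root_len_def)
    then show "(\<Sum>j\<in>{1..<n}. of_bool (j < root_len n v \<and> (v \<in> B) \<noteq> (add_cycle j v \<in> B))) =
        real (card {j \<in> {1..<root_len n v}. (v \<in> B) \<noteq> (add_cycle j v \<in> B)})"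
      by (subst sum_of_bool_eq) auto
  qed
  finally have E: "(\<Sum>y\<in>B. weight n y * (ln (real (root_len n y)) - (\<Sum>j\<in>{1..<n}. ln (P y j)))) \<le>
      3 * (2 + ln (real M)) * \<beta> + 16 * real n / 2 ^ M"
    using sum_tail_le[OF M, of n] by linarith
  have "(\<Sum>y\<in>B. weight n y * ln (real n / real (root_len n y))) =
      (\<Sum>y\<in>B. weight n y * (ln (real n) - ln (real (root_len n y))))"
  proof (intro sum.cong refl)
    fix y assume "y \<in> B"
    then have "root_len n y \<in> {1..n}" using root_len_rooted_types B(1) by blast
    then show "weight n y * ln (real n / real (root_len n y)) = weight n y * (ln (real n) - ln (real (root_len n y)))"
      using n by (simp add: ln_div)
  qed
  also have "\<dots> = S * ln (real n) - (\<Sum>y\<in>B. weight n y * ln (real (root_len n y)))"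
    by (simp add: right_diff_distrib sum_subtractf S_def sum_distrib_right)
  finally have "S * ln (real n) - (\<Sum>y\<in>B. weight n y * ln (real (root_len n y))) \<le> 2 / 3 * S * ln (18 * real n / S)"
    using sum_ln_root_len_le[OF n B sym] unfolding S_def by simp
  moreover have "S * ln (real n / S) = S * ln (real n) - S * ln S"
    using n Spos by (simp add: ln_div right_diff_distrib)
  ultimately show ?thesis using A E by (simp add: right_diff_distrib sum_subtractf)
qed

section \<open>The edge boundary of a conjugation-invariant set\<close>

lemma conj_transpose:
  assumes "bij \<rho>"
  shows "\<rho> \<circ> transpose a c \<circ> inv \<rho> = transpose (\<rho> a) (\<rho> c)"
proof
  fix x
  obtain z where z: "x = \<rho> z" using assms by (meson bij_pointE)
  show "(\<rho> \<circ> transpose a c \<circ> inv \<rho>) x = transpose (\<rho> a) (\<rho> c) x"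
    using inj_eq[OF bij_is_inj[OF assms], of z a] inj_eq[OF bij_is_inj[OF assms], of z c]
    by (cases "z = a"; cases "z = c") (simp_all add: z inv_f_f[OF bij_is_inj[OF assms]])
qed

text \<open>Edges are defined by left multiplication, but \<sigma> t = (\<sigma> t \<sigma>^-1)
  \<sigma>, so right multiplication by transpositions gives the same edges; it is the side on which
  \<open>merge_bij\<close> operates.\<close>

definition exits :: "('a \<Rightarrow> 'a) set \<Rightarrow> ('a \<Rightarrow> 'a) \<Rightarrow> nat" where
  "exits A g = card {\<sigma> \<in> A. \<sigma> \<circ> g \<notin> A}"

lemma finite_Sym: "finite (Sym n)"
  unfolding Sym_def by (rule finite_permutations) simp

lemma Sym_comp: "g \<in> Sym n \<Longrightarrow> h \<in> Sym n \<Longrightarrow> g \<circ> h \<in> Sym n"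
  by (simp add: Sym_def permutes_compose)

lemma Sym_inv: "g \<in> Sym n \<Longrightarrow> inv g \<in> Sym n"
  by (simp add: Sym_def permutes_inv)

lemma Sym_transpose: "a \<in> {1..n} \<Longrightarrow> c \<in> {1..n} \<Longrightarrow> transpose a c \<in> Sym n"
  unfolding Sym_def mem_Collect_eq by (rule permutes_swap_id)

lemma Sym_bij: "g \<in> Sym n \<Longrightarrow> bij g"
  by (auto simp: Sym_def permutes_bij)

text \<open>On the way \<sigma>, \<sigma> g, \<sigma> g h the set is left at the first step or at
  the second.\<close>

lemma exits_comp:
  assumes A: "finite A" and g: "bij g"
  shows "exits A (g \<circ> h) \<le> exits A g + exits A h"
proof -
  have fin: "finite {\<sigma> \<in> A. P \<sigma>}" for P using A by simp
  have "{\<sigma> \<in> A. \<sigma> \<circ> (g \<circ> h) \<notin> A} \<subseteq> {\<sigma> \<in> A. \<sigma> \<circ> g \<notin> A} \<union> (\<lambda>\<pi>. \<pi> \<circ> inv g) ` {\<pi> \<in> A. \<pi> \<circ> h \<notin> A}"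
  proof
    fix \<sigma> assume \<sigma>: "\<sigma> \<in> {\<sigma> \<in> A. \<sigma> \<circ> (g \<circ> h) \<notin> A}"
    have "\<sigma> = (\<sigma> \<circ> g) \<circ> inv g"
      using g by (simp add: comp_assoc bij_is_surj surj_iff[THEN iffD1])
    then have "\<sigma> \<in> (\<lambda>\<pi>. \<pi> \<circ> inv g) ` {\<pi> \<in> A. \<pi> \<circ> h \<notin> A}" if "\<sigma> \<circ> g \<in> A"
      using \<sigma> that by (intro image_eqI[of _ _ "\<sigma> \<circ> g"]) (auto simp: comp_assoc)
    then show "\<sigma> \<in> {\<sigma> \<in> A. \<sigma> \<circ> g \<notin> A} \<union> (\<lambda>\<pi>. \<pi> \<circ> inv g) ` {\<pi> \<in> A. \<pi> \<circ> h \<notin> A}"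
      using \<sigma> by blast
  qed
  then have "exits A (g \<circ> h) \<le>
      card ({\<sigma> \<in> A. \<sigma> \<circ> g \<notin> A} \<union> (\<lambda>\<pi>. \<pi> \<circ> inv g) ` {\<pi> \<in> A. \<pi> \<circ> h \<notin> A})"
    unfolding exits_def using fin by (intro card_mono) auto
  also have "\<dots> \<le> exits A g + card ((\<lambda>\<pi>. \<pi> \<circ> inv g) ` {\<pi> \<in> A. \<pi> \<circ> h \<notin> A})"
    unfolding exits_def by (rule card_Un_le)
  also have "\<dots> \<le> exits A g + exits A h"
    unfolding exits_def using fin by (intro add_left_mono card_image_le)
  finally show ?thesis .
qed

lemma exits_conj:
  assumes A: "finite A" "conjugation_invariant n A" and \<rho>: "\<rho> \<in> Sym n"
  shows "exits A g \<le> exits A (\<rho> \<circ> g \<circ> inv \<rho>)"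
  unfolding exits_def
proof (rule card_inj_on_le[where f = "\<lambda>\<sigma>. \<rho> \<circ> \<sigma> \<circ> inv \<rho>"])
  have b: "bij \<rho>" using \<rho> by (rule Sym_bij)
  have i: "inv \<rho> \<circ> \<rho> = id" using b by (simp add: bij_is_inj)
  have cancel: "inv \<rho> \<circ> (\<rho> \<circ> \<sigma> \<circ> inv \<rho>) \<circ> \<rho> = \<sigma>" for \<sigma>
    using i by (simp add: fun_eq_iff)
  show "inj_on (\<lambda>\<sigma>. \<rho> \<circ> \<sigma> \<circ> inv \<rho>) {\<sigma> \<in> A. \<sigma> \<circ> g \<notin> A}"
    by (rule inj_onI) (metis cancel)
  show "(\<lambda>\<sigma>. \<rho> \<circ> \<sigma> \<circ> inv \<rho>) ` {\<sigma> \<in> A. \<sigma> \<circ> g \<notin> A} \<subseteq> {\<sigma> \<in> A. \<sigma> \<circ> (\<rho> \<circ> g \<circ> inv \<rho>) \<notin> A}"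
  proof clarify
    fix \<sigma> assume \<sigma>: "\<sigma> \<in> A" "\<sigma> \<circ> g \<notin> A"
    have "\<rho> \<circ> \<sigma> \<circ> inv \<rho> \<in> A" using A(2) \<sigma>(1) \<rho> by (auto simp: conjugation_invariant_def)
    moreover have "\<rho> \<circ> \<sigma> \<circ> inv \<rho> \<circ> (\<rho> \<circ> g \<circ> inv \<rho>) = \<rho> \<circ> (\<sigma> \<circ> g) \<circ> inv \<rho>"
      using i by (simp add: fun_eq_iff)
    moreover have "\<rho> \<circ> (\<sigma> \<circ> g) \<circ> inv \<rho> \<notin> A"
    proof
      assume "\<rho> \<circ> (\<sigma> \<circ> g) \<circ> inv \<rho> \<in> A"
      then have "inv \<rho> \<circ> (\<rho> \<circ> (\<sigma> \<circ> g) \<circ> inv \<rho>) \<circ> inv (inv \<rho>) \<in> A"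
        using A(2) Sym_inv[OF \<rho>] unfolding conjugation_invariant_def by blast
      then show False using \<sigma>(2) by (simp only: inv_inv_eq[OF b] cancel)
    qed
    ultimately show "\<rho> \<circ> \<sigma> \<circ> inv \<rho> \<in> A \<and> \<rho> \<circ> \<sigma> \<circ> inv \<rho> \<circ> (\<rho> \<circ> g \<circ> inv \<rho>) \<notin> A" by simp
  qed
qed (use A in simp)

lemma exits_transpose_le:
  assumes A: "finite A" "conjugation_invariant n A"
    and ac: "a \<in> {1..n}" "c \<in> {1..n}" "a \<noteq> c" and ac': "a' \<in> {1..n}" "c' \<in> {1..n}" "a' \<noteq> c'"
  shows "exits A (transpose a c) \<le> exits A (transpose a' c')"
proof -
  \<comment> \<open>The first swap moves \<open>a\<close> to \<open>a'\<close> and \<open>c\<close>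
    to \<open>c1\<close>. The second moves \<open>c1\<close> to \<open>c'\<close> and leaves
    \<open>a'\<close> alone, as neither \<open>c1\<close> nor \<open>c'\<close> equals
    \<open>a'\<close>.\<close>
  define c1 where "c1 = transpose a a' c"
  define \<rho> where "\<rho> = transpose c1 c' \<circ> transpose a a'"
  have c1: "c1 \<in> {1..n}" "c1 \<noteq> a'" using ac ac' by (auto simp: c1_def transpose_def)
  have \<rho>: "\<rho> \<in> Sym n" unfolding \<rho>_def by (intro Sym_comp Sym_transpose ac ac' c1)
  have "\<rho> a = a'" "\<rho> c = c'" using c1 ac' by (auto simp: \<rho>_def c1_def[symmetric])
  then have "transpose a' c' = \<rho> \<circ> transpose a c \<circ> inv \<rho>"
    using conj_transpose[OF Sym_bij[OF \<rho>]] by simp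
  then show ?thesis using exits_conj[OF A \<rho>] by simp
qed

lemma transpose_inject:
  assumes "transpose a c = transpose a' c'" "a < c" "a' < (c' :: nat)"
  shows "a = a' \<and> c = c'"
  using assms(2,3) fun_cong[OF assms(1), of a] fun_cong[OF assms(1), of c]
  by (auto simp: transpose_def split: if_splits)

text \<open>A boundary edge has a single endpoint in \<open>A\<close>, and that endpoint with the
  other one determines the transposition. So the n (n - 1) / 2 transpositions contribute disjoint
  sets of edges.\<close>

lemma edge_boundary_ge:
  assumes A: "A \<subseteq> Sym n" and le: "\<And>a c. a \<in> {1..n} \<Longrightarrow> c \<in> {1..n} \<Longrightarrow> a \<noteq> c \<Longrightarrow> d \<le> exits A (transpose a c)"
  shows "n * (n - 1) * d \<le> 2 * card (edge_boundary n A)"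
proof -
  have finA: "finite A" using A finite_Sym by (rule finite_subset)
  let ?P = "SIGMA c:{1..n}. {1..<c}"
  let ?X = "SIGMA (c, a):?P. {\<sigma> \<in> A. \<sigma> \<circ> transpose a c \<notin> A}"
  let ?f = "\<lambda>((c, a), \<sigma>). {\<sigma>, \<sigma> \<circ> transpose a c}"
  have "edge_boundary n A \<subseteq> Pow (Sym n)"
    by (auto simp: edge_boundary_def transposition_graph_edges_def)
  then have finE: "finite (edge_boundary n A)"
    by (rule finite_subset) (simp add: finite_Sym)
  have inj: "inj_on ?f ?X"
  proof (rule inj_onI)
    fix x x' assume "x \<in> ?X" "x' \<in> ?X" and eq: "?f x = ?f x'"
    then obtain c a \<sigma> c' a' \<sigma>' where x: "x = ((c, a), \<sigma>)" "a < c" "\<sigma> \<in> A" "\<sigma> \<circ> transpose a c \<notin> A"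
      and x': "x' = ((c', a'), \<sigma>')" "a' < c'" "\<sigma>' \<in> A" "\<sigma>' \<circ> transpose a' c' \<notin> A" by auto
    have "{\<sigma>, \<sigma> \<circ> transpose a c} = {\<sigma>', \<sigma>' \<circ> transpose a' c'}" using eq x(1) x'(1) by simp
    then consider "\<sigma> = \<sigma>'" "\<sigma> \<circ> transpose a c = \<sigma>' \<circ> transpose a' c'" | "\<sigma> = \<sigma>' \<circ> transpose a' c'"
      unfolding doubleton_eq_iff by blast
    \<comment> \<open>A crosswise match of the endpoints is impossible, since it would put the outer
      endpoint of one edge into \<open>A\<close>.\<close>
    then have s: "\<sigma> = \<sigma>'" "\<sigma> \<circ> transpose a c = \<sigma>' \<circ> transpose a' c'"
      using x(3) x'(4) by (cases; blast)+
    have "bij \<sigma>" using A x(3) by (intro Sym_bij[of _ n]) auto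
    then have "inv \<sigma> \<circ> \<sigma> = id" by (simp add: bij_is_inj)
    moreover have "(inv \<sigma> \<circ> \<sigma>) \<circ> transpose a c = (inv \<sigma> \<circ> \<sigma>) \<circ> transpose a' c'"
      using s by (simp only: comp_assoc)
    ultimately have "transpose a c = transpose a' c'" by (simp only: id_comp)
    then show "x = x'" using transpose_inject[of a c a' c'] x(1,2) x'(1,2) s(1) by simp
  qed
  have sub: "?f ` ?X \<subseteq> edge_boundary n A"
  proof
    fix e assume "e \<in> ?f ` ?X"
    then obtain c a \<sigma> where x: "e = {\<sigma>, \<sigma> \<circ> transpose a c}" "c \<in> {1..n}" "a \<in> {1..<c}" "\<sigma> \<in> A"
      "\<sigma> \<circ> transpose a c \<notin> A" by auto
    have \<sigma>: "\<sigma> \<in> Sym n" "bij \<sigma>" using x(4) A Sym_bij by auto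
    have a: "a \<in> {1..n}" "a \<noteq> c" using x(2,3) by auto
    have "inv (\<sigma> \<circ> transpose a c) = transpose a c \<circ> inv \<sigma>"
      using \<sigma>(2) by (subst o_inv_distrib) auto
    then have "\<sigma> \<circ> inv (\<sigma> \<circ> transpose a c) = transpose (\<sigma> a) (\<sigma> c)"
      using conj_transpose[OF \<sigma>(2)] by (simp add: comp_assoc)
    moreover have "\<sigma> a \<in> {1..n}" "\<sigma> c \<in> {1..n}" "\<sigma> a \<noteq> \<sigma> c"
      using \<sigma> a x(2) permutes_in_image[of \<sigma> "{1..n}"] by (auto simp: Sym_def bij_is_inj inj_eq)
    ultimately have "is_transposition n (\<sigma> \<circ> inv (\<sigma> \<circ> transpose a c))"
      unfolding is_transposition_def by blast
    moreover have "\<sigma> \<circ> transpose a c \<in> Sym n" using \<sigma>(1) a x(2) by (intro Sym_comp Sym_transpose)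
    ultimately have "e \<in> transposition_graph_edges n"
      unfolding transposition_graph_edges_def x(1) using \<sigma>(1) by blast
    moreover have "e \<inter> A = {\<sigma>}" using x by auto
    ultimately show "e \<in> edge_boundary n A" by (simp add: edge_boundary_def)
  qed
  have cP: "2 * card ?P = n * (n - 1)"
  proof -
    have "card ?P = (\<Sum>c\<in>{1..n}. c - 1)" by (subst card_SigmaI) auto
    moreover have "2 * (\<Sum>c\<in>{1..n}. c - 1) = n * (n - 1)"
    proof (induction n)
      case (Suc n)
      then show ?case by (cases n) auto
    qed simp
    ultimately show ?thesis by simp
  qed
  have "card ?P * d = (\<Sum>x\<in>?P. d)" by simp
  also have "\<dots> \<le> (\<Sum>x\<in>?P. card (case x of (c, a) \<Rightarrow> {\<sigma> \<in> A. \<sigma> \<circ> transpose a c \<notin> A}))"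
    by (intro sum_mono) (use le in \<open>auto simp: exits_def\<close>)
  also have "\<dots> = card ?X"
    using finA by (intro card_SigmaI[symmetric]) auto
  also have "\<dots> \<le> card (edge_boundary n A)"
    using card_inj_on_le[OF inj sub finE] .
  finally have "2 * card ?P * d \<le> 2 * card (edge_boundary n A)" by simp
  then show ?thesis unfolding cP by simp
qed

lemma exits_le_card_times:
  assumes A: "finite A" and d: "\<And>a c. a \<in> S \<Longrightarrow> c \<in> S \<Longrightarrow> a \<noteq> c \<Longrightarrow> exits A (transpose a c) \<le> d"
    and S: "finite S" and g: "g permutes S"
  shows "exits A g \<le> card S * d"
  using S g d
proof (induction S arbitrary: g rule: finite_induct)
  case empty
  then have "g = id" by (simp only: permutes_empty)
  then show ?case by (simp only: exits_def comp_id) simp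
next
  case (insert a S)
  have id: "exits A id = 0" by (simp add: exits_def)
  \<comment> \<open>Composing with this swap makes \<open>a\<close> a fixed point, so one swap per
    element of the set suffices; if \<open>g a = a\<close> it is the identity, which has no
    exits.\<close>
  define h where "h = transpose a (g a) \<circ> g"
  have h: "h permutes S" unfolding h_def using permutes_insert_lemma[OF insert.prems(1)] .
  have ga: "g a \<in> insert a S" using permutes_in_image[OF insert.prems(1), of a] by simp
  have "g = transpose a (g a) \<circ> h" by (simp add: h_def fun_eq_iff)
  then have "exits A g \<le> exits A (transpose a (g a)) + exits A h"
    using exits_comp[OF A, of "transpose a (g a)" h] by simp
  also have "exits A (transpose a (g a)) \<le> d"
    using insert.prems(2)[of a "g a"] ga id by (cases "g a = a") auto
  also have "exits A h \<le> card S * d" using insert.IH[OF h] insert.prems(2) by blast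
  finally show ?case using insert.hyps by simp
qed

text \<open>Each element of \<open>A\<close> and each permutation outside \<open>A\<close> are
  joined by exactly one \<open>g\<close>.\<close>

lemma sum_exits:
  assumes A: "A \<subseteq> Sym n"
  shows "(\<Sum>g\<in>Sym n. exits A g) = card A * (fact n - card A)"
proof -
  have finA: "finite A" using A finite_Sym by (rule finite_subset)
  have cS: "card (Sym n) = fact n" unfolding Sym_def by (simp add: card_permutations)
  have "(\<Sum>g\<in>Sym n. exits A g) = card (SIGMA g:Sym n. {\<sigma> \<in> A. \<sigma> \<circ> g \<notin> A})"
    unfolding exits_def using finA finite_Sym by (intro card_SigmaI[symmetric]) auto
  also have "\<dots> = card (A \<times> (Sym n - A))"
  proof (rule bij_betw_same_card, rule bij_betwI[where f = "\<lambda>(g, \<sigma>). (\<sigma>, \<sigma> \<circ> g)" and g = "\<lambda>(\<sigma>, \<pi>). (inv \<sigma> \<circ> \<pi>, \<sigma>)"])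
    have c: "\<sigma> \<circ> (inv \<sigma> \<circ> \<pi>) = \<pi>" "inv \<sigma> \<circ> (\<sigma> \<circ> \<pi>) = \<pi>" if "\<sigma> \<in> A" for \<sigma> \<pi>
      using Sym_bij[of \<sigma> n] that A
      by (auto simp: fun_eq_iff bij_is_inj bij_is_surj surj_f_inv_f)
    show "(\<lambda>(g, \<sigma>). (\<sigma>, \<sigma> \<circ> g)) \<in> (SIGMA g:Sym n. {\<sigma> \<in> A. \<sigma> \<circ> g \<notin> A}) \<rightarrow> A \<times> (Sym n - A)"
      using A Sym_comp by auto
    show "(\<lambda>(\<sigma>, \<pi>). (inv \<sigma> \<circ> \<pi>, \<sigma>)) \<in> A \<times> (Sym n - A) \<rightarrow> (SIGMA g:Sym n. {\<sigma> \<in> A. \<sigma> \<circ> g \<notin> A})"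
      using A Sym_comp Sym_inv by (auto simp: c)
    show "(case case x of (g, \<sigma>) \<Rightarrow> (\<sigma>, \<sigma> \<circ> g) of (\<sigma>, \<pi>) \<Rightarrow> (inv \<sigma> \<circ> \<pi>, \<sigma>)) = x"
      if "x \<in> (SIGMA g:Sym n. {\<sigma> \<in> A. \<sigma> \<circ> g \<notin> A})" for x
      using that by (auto simp: c)
    show "(case case x of (\<sigma>, \<pi>) \<Rightarrow> (inv \<sigma> \<circ> \<pi>, \<sigma>) of (g, \<sigma>) \<Rightarrow> (\<sigma>, \<sigma> \<circ> g)) = x"
      if "x \<in> A \<times> (Sym n - A)" for x
      using that by (auto simp: c)
  qed
  also have "\<dots> = card A * (fact n - card A)"
    using A finA by (simp add: card_cartesian_product card_Diff_subset cS)
  finally show ?thesis .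
qed

section \<open>Conjugation-invariant sets as sets of rooted types\<close>

lemma cycle_counts_determines_membership:
  assumes A: "A \<subseteq> Sym n" "conjugation_invariant n A" and n: "n > 0"
  shows "A = {\<sigma>. \<sigma> permutes {1..n} \<and> cycle_counts {1..n} 1 \<sigma> \<in> cycle_counts {1..n} 1 ` A}"
proof (intro equalityI subsetI)
  fix \<sigma> assume "\<sigma> \<in> {\<sigma>. \<sigma> permutes {1..n} \<and> cycle_counts {1..n} 1 \<sigma> \<in> cycle_counts {1..n} 1 ` A}"
  then obtain \<pi> where \<pi>: "\<pi> \<in> A" "cycle_counts {1..n} 1 \<pi> = cycle_counts {1..n} 1 \<sigma>" and \<sigma>: "\<sigma> permutes {1..n}" by auto
  have "\<pi> permutes {1..n}" using A(1) \<pi>(1) by (auto simp: Sym_def)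
  then obtain \<rho> where \<rho>: "\<rho> permutes {1..n}" "\<rho> \<circ> \<pi> = \<sigma> \<circ> \<rho>"
    using cycle_counts_eq_imp_conj[of "{1..n}" 1 \<pi> \<sigma>] \<pi>(2) \<sigma> n by auto
  have "\<rho> \<circ> \<pi> \<circ> inv \<rho> = \<sigma>"
    unfolding \<rho>(2) using permutes_inv_o(1)[OF \<rho>(1)] by (simp add: comp_assoc)
  moreover have "\<rho> \<circ> \<pi> \<circ> inv \<rho> \<in> A"
    using A(2) \<pi>(1) \<rho>(1) by (auto simp: conjugation_invariant_def Sym_def)
  ultimately show "\<sigma> \<in> A" by simp
qed (use A(1) in \<open>auto simp: Sym_def\<close>)

text \<open>A permutation of type \<open>add_cycle i y\<close> has a root cycle of length
  \<open>j\<close> and another cycle of length \<open>i\<close>. Conjugating by the swap of 1 with a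
  point of the latter exchanges the two cycles and stays in \<open>A\<close>. This supplies the
  hypothesis \<open>sym\<close> of the entropy bounds.\<close>

lemma cycle_counts_image_symmetric:
  assumes A: "A \<subseteq> Sym n" "conjugation_invariant n A"
    and y: "y \<in> rooted_types n" "1 \<le> i" "1 \<le> j" "i + j = root_len n y"
    and i: "add_cycle i y \<in> cycle_counts {1..n} 1 ` A"
  shows "add_cycle j y \<in> cycle_counts {1..n} 1 ` A"
proof -
  let ?S = "{1..n}"
  have n: "1 \<in> ?S" using y by (auto simp: root_len_def)
  obtain \<sigma> where \<sigma>: "\<sigma> \<in> A" "cycle_counts ?S 1 \<sigma> = add_cycle i y" using i by auto
  have p: "\<sigma> permutes ?S" using A(1) \<sigma>(1) by (auto simp: Sym_def)
  have "card {k \<in> ?S. k \<notin> orbit \<sigma> 1 \<and> card (orbit \<sigma> k) = i} = i * Suc (y i)"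
    using card_orbit_elements[OF _ n p, of i] \<sigma>(2) by (simp add: add_cycle_def)
  then have "{k \<in> ?S. k \<notin> orbit \<sigma> 1 \<and> card (orbit \<sigma> k) = i} \<noteq> {}"
    using y(2) by (metis card.empty mult_eq_0_iff nat.distinct(1) not_one_le_zero)
  then obtain x where x: "x \<in> ?S" "x \<notin> orbit \<sigma> 1" "card (orbit \<sigma> x) = i" by auto
  have root: "card (orbit \<sigma> 1) = j"
    using cycle_counts_rooted_types(2)[OF _ n p] \<sigma>(2) add_cycle_rooted_types(2)[OF y(1,2)] y by simp
  have "cycle_counts ?S x \<sigma> t = add_cycle j y t" for t
    using cycle_counts_root_change[OF _ p n x(1,2), of t] \<sigma>(2) x(3) root
    by (auto simp: add_cycle_def split: if_splits)
  then have cx: "cycle_counts ?S x \<sigma> = add_cycle j y" by auto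
  define \<rho> where "\<rho> = transpose 1 x"
  have \<rho>: "\<rho> permutes ?S" unfolding \<rho>_def using n x(1) by (intro permutes_swap_id)
  have "cycle_counts ?S (\<rho> x) (\<rho> \<circ> \<sigma> \<circ> inv \<rho>) = add_cycle j y"
    using cycle_counts_conj[OF _ p \<rho>, of x] cx by simp
  moreover have "\<rho> x = 1" by (simp add: \<rho>_def)
  moreover have "\<rho> \<circ> \<sigma> \<circ> inv \<rho> \<in> A"
    using A(2) \<sigma>(1) \<rho> by (auto simp: conjugation_invariant_def Sym_def)
  ultimately show ?thesis by (intro image_eqI[of _ _ "\<rho> \<circ> \<sigma> \<circ> inv \<rho>"]) simp_all
qed

text \<open>The involution pairs crossings that start inside \<open>A\<close> with those that start
  outside.\<close>

lemma card_crossing_le: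
  assumes A: "A \<subseteq> Sym n" and t: "t \<circ> t = id"
  shows "card {\<sigma> \<in> Sym n. (\<sigma> \<in> A) \<noteq> (\<sigma> \<circ> t \<in> A)} \<le> 2 * exits A t"
proof -
  have finA: "finite A" using A finite_Sym by (rule finite_subset)
  let ?E = "{\<sigma> \<in> A. \<sigma> \<circ> t \<notin> A}"
  have tt: "\<sigma> \<circ> t \<circ> t = \<sigma>" for \<sigma> :: "nat \<Rightarrow> nat" using t by (simp add: comp_assoc)
  have "{\<sigma> \<in> Sym n. (\<sigma> \<in> A) \<noteq> (\<sigma> \<circ> t \<in> A)} \<subseteq> ?E \<union> (\<lambda>\<sigma>. \<sigma> \<circ> t) ` ?E"
  proof
    fix \<sigma> assume \<sigma>: "\<sigma> \<in> {\<sigma> \<in> Sym n. (\<sigma> \<in> A) \<noteq> (\<sigma> \<circ> t \<in> A)}"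
    show "\<sigma> \<in> ?E \<union> (\<lambda>\<sigma>. \<sigma> \<circ> t) ` ?E"
    proof (cases "\<sigma> \<in> A")
      case False
      then have "\<sigma> \<circ> t \<in> ?E" using \<sigma> by (simp add: tt)
      then show ?thesis using tt[of \<sigma>] by (metis (no_types, lifting) UnI2 image_eqI)
    qed (use \<sigma> in simp)
  qed
  then have "card {\<sigma> \<in> Sym n. (\<sigma> \<in> A) \<noteq> (\<sigma> \<circ> t \<in> A)} \<le> card (?E \<union> (\<lambda>\<sigma>. \<sigma> \<circ> t) ` ?E)"
    using finA by (intro card_mono) auto
  also have "\<dots> \<le> card ?E + card ((\<lambda>\<sigma>. \<sigma> \<circ> t) ` ?E)" by (rule card_Un_le)
  also have "\<dots> \<le> card ?E + card ?E" using finA by (intro add_left_mono card_image_le) auto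
  finally show ?thesis by (simp add: exits_def)
qed

text \<open>Let d be the common number of exits, so n (n - 1) d \<le> 2 |boundary|. The mean of
  \<open>exits\<close> over all g is at least |A| / 2 and at most n d, which gives the first bound
  with n \<le> 2 (n - 1). The n - 1 transpositions at the root have at most 2 d crossings each,
  which gives the second.\<close>

lemma edge_boundary_bounds:
  assumes A: "A \<subseteq> Sym n" "conjugation_invariant n A" and n: "n \<ge> 2" and half: "2 * card A \<le> fact n"
  shows "n * card A \<le> 8 * card (edge_boundary n A)"
    and "n * card {(\<sigma>, k). \<sigma> permutes {1..n} \<and> k \<in> {1..n} \<and> k \<notin> orbit \<sigma> 1 \<and> (\<sigma> \<in> A) \<noteq> (\<sigma> \<circ> transpose 1 k \<in> A)}
      \<le> 4 * card (edge_boundary n A)"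
proof -
  have finA: "finite A" using A(1) finite_Sym by (rule finite_subset)
  define d where "d = exits A (transpose 1 2)"
  have d: "d \<le> exits A (transpose a c)" "exits A (transpose a c) \<le> d"
    if "a \<in> {1..n}" "c \<in> {1..n}" "a \<noteq> c" for a c
    unfolding d_def using n that by (intro exits_transpose_le[OF finA A(2)]; simp)+
  have bd: "n * (n - 1) * d \<le> 2 * card (edge_boundary n A)"
    by (rule edge_boundary_ge[OF A(1) d(1)])
  have "card A * (fact n - card A) = (\<Sum>g\<in>Sym n. exits A g)" by (rule sum_exits[OF A(1), symmetric])
  also have "\<dots> \<le> (\<Sum>g\<in>Sym n. n * d)"
    using exits_le_card_times[OF finA d(2), of "{1..n}"] by (intro sum_mono) (simp add: Sym_def)
  also have "\<dots> = fact n * (n * d)" by (simp add: Sym_def card_permutations)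
  finally have le: "card A * (fact n - card A) \<le> fact n * (n * d)" .
  have "fact n * card A \<le> 2 * (fact n - card A) * card A"
    using half by (intro mult_le_mono1) simp
  also have "\<dots> = 2 * (card A * (fact n - card A))" by (simp only: mult_ac)
  also have "\<dots> \<le> 2 * (fact n * (n * d))" using le by (rule mult_le_mono2)
  also have "\<dots> = fact n * (2 * n * d)" by (simp only: mult_ac)
  finally have "card A \<le> 2 * n * d" by simp
  then have "(n - 1) * card A \<le> (n - 1) * (2 * n * d)" by (rule mult_le_mono2)
  also have "\<dots> = 2 * (n * (n - 1) * d)" by simp
  finally have "(n - 1) * card A \<le> 4 * card (edge_boundary n A)" using bd by linarith
  then have "2 * ((n - 1) * card A) \<le> 8 * card (edge_boundary n A)" by linarith
  moreover have "n * card A \<le> (2 * (n - 1)) * card A" using n by (intro mult_le_mono1) simp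
  ultimately show "n * card A \<le> 8 * card (edge_boundary n A)" by (simp only: mult.assoc)
  let ?N = "{(\<sigma>, k). \<sigma> permutes {1..n} \<and> k \<in> {1..n} \<and> k \<notin> orbit \<sigma> 1 \<and> (\<sigma> \<in> A) \<noteq> (\<sigma> \<circ> transpose 1 k \<in> A)}"
  let ?C = "\<lambda>k. {\<sigma> \<in> Sym n. (\<sigma> \<in> A) \<noteq> (\<sigma> \<circ> transpose 1 k \<in> A)}"
  have finC: "finite (?C k)" for k using finite_Sym[of n] by simp
  have "?N \<subseteq> (\<lambda>(k, \<sigma>). (\<sigma>, k)) ` (SIGMA k:{2..n}. ?C k)"
  proof clarify
    fix \<sigma> k
    assume a: "\<sigma> permutes {1..n}" "k \<in> {1..n}" "k \<notin> orbit \<sigma> 1" "(\<sigma> \<in> A) \<noteq> (\<sigma> \<circ> transpose 1 k \<in> A)"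
    have "1 \<in> orbit \<sigma> 1" using permutes_permutation[OF _ a(1)] by (intro permutation_self_in_orbit) simp
    then have "k \<noteq> 1" using a(3) by auto
    then have "(k, \<sigma>) \<in> (SIGMA k:{2..n}. ?C k)" using a by (auto simp: Sym_def)
    then show "(\<sigma>, k) \<in> (\<lambda>(k, \<sigma>). (\<sigma>, k)) ` (SIGMA k:{2..n}. ?C k)" by force
  qed
  then have "card ?N \<le> card ((\<lambda>(k, \<sigma>). (\<sigma>, k)) ` (SIGMA k:{2..n}. ?C k))"
    using finC by (intro card_mono finite_imageI finite_SigmaI) auto
  also have "\<dots> \<le> card (SIGMA k:{2..n}. ?C k)"
    using finC by (intro card_image_le finite_SigmaI) auto
  also have "\<dots> = (\<Sum>k\<in>{2..n}. card (?C k))" using finC by (intro card_SigmaI) auto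
  also have "\<dots> \<le> (\<Sum>k\<in>{2..n}. 2 * d)"
  proof (intro sum_mono)
    fix k assume "k \<in> {2..n}"
    then have "exits A (transpose 1 k) \<le> d" using n by (intro d(2)) auto
    then show "card (?C k) \<le> 2 * d"
      using card_crossing_le[OF A(1), of "transpose 1 k"] by simp
  qed
  also have "\<dots> = (n - 1) * (2 * d)" using n by simp
  finally have "n * card ?N \<le> n * ((n - 1) * (2 * d))" by (rule mult_le_mono2)
  also have "\<dots> = 2 * (n * (n - 1) * d)" by simp
  finally show "n * card ?N \<le> 4 * card (edge_boundary n A)" using bd by linarith
qed

section \<open>Choice of the cutoff and final constants\<close>

lemma ln_2_ge_half: "1 / 2 \<le> ln (2::real)"
  using ln_le_minus_one[of "1 / 2 :: real"] by (simp add: ln_div)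

text \<open>The additive losses are (2/3) * 17 + 16 < 28, where 17 bounds ln 18. The remaining ln
  (1/p) / 3 - 28 is at least ln (1/p) / 6 once ln (1/p) \<ge> 168, which the threshold 180
  guarantees. In 108 = 9 * 12 the 9 comes from the boundary term, and 12 = 6 * 2 includes the
  passage from ln to log 2.\<close>

lemma small_sets_bound:
  fixes S p \<beta> :: real
  assumes n: "n > 0" and p: "0 < p" "ln (1 / p) \<ge> 180" and S: "S = real n * p" and \<beta>: "\<beta> \<ge> 0"
    and ent: "\<And>M. M \<ge> 3 \<Longrightarrow> S * ln (real n / S) \<le>
      2 / 3 * S * ln (18 * real n / S) + 3 * (2 + ln (real M)) * \<beta> + 16 * real n / 2 ^ M"
  shows "S * (log 2 (1 / p) / log 2 (log 2 (2 / p))) \<le> 108 * \<beta>"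
proof -
  define L where "L = log 2 (2 / p)"
  define LL where "LL = log 2 L"
  \<comment> \<open>Large enough that 2^M \<ge> 1/p, so the tail is at most 16 \<open>S\<close>, and
    small enough that ln M \<le> \<open>LL\<close>.\<close>
  define M where "M = nat \<lceil>log 2 (1 / p)\<rceil>"
  have Spos: "S > 0" using n p S by simp
  have ln2: "1 / 2 \<le> ln (2::real)" "ln (2::real) \<le> 1" using ln_2_ge_half ln_le_minus_one[of "2::real"] by auto
  have l1: "ln (1 / p) = ln 2 * log 2 (1 / p)" by (simp add: log_def)
  have lp: "log 2 (1 / p) \<ge> 180"
  proof -
    have "180 \<le> ln (1 / p) / 1" using p(2) by simp
    also have "\<dots> \<le> ln (1 / p) / ln 2" using p(2) ln2 by (intro divide_left_mono) auto
    finally show ?thesis by (simp add: log_def)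
  qed
  have L: "L = log 2 (1 / p) + 1"
    using p(1) log_mult[of 2 "1 / p" 2] by (simp add: L_def log_divide)
  have M: "real M \<ge> log 2 (1 / p)" "real M \<le> L" "M \<ge> 3"
    unfolding L M_def using lp by linarith+
  have LL: "LL \<ge> 1" unfolding LL_def using L lp by simp
  have "ln (real M) \<le> ln L" using M by (intro ln_mono) auto
  also have "\<dots> = ln 2 * LL" by (simp add: LL_def log_def)
  also have "\<dots> \<le> 1 * LL" using LL ln2 by (intro mult_right_mono) auto
  finally have lnM: "2 + ln (real M) \<le> 3 * LL" using LL by simp
  have "1 / p = 2 powr log 2 (1 / p)" using p by simp
  also have "\<dots> \<le> 2 powr real M" using M by (intro powr_mono) auto
  also have "\<dots> = 2 ^ M" by (simp add: powr_realpow)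
  finally have "1 / 2 ^ M \<le> p" using p by (simp add: field_simps)
  then have tail: "16 * real n / 2 ^ M \<le> 16 * S"
    using n S mult_left_mono[of "1 / 2 ^ M" p "16 * real n"] by simp
  have nS: "real n / S = 1 / p" "18 * real n / S = 18 * (1 / p)" using n S by simp_all
  have "ln (18 * (1 / p)) = ln 18 + ln (1 / p)" using p by (intro ln_mult_pos) auto
  also have "\<dots> \<le> 17 + ln (1 / p)" using ln_le_minus_one[of "18::real"] by simp
  finally have "2 / 3 * S * ln (18 * real n / S) \<le> 2 / 3 * S * (17 + ln (1 / p))"
    unfolding nS using Spos by (intro mult_left_mono) auto
  moreover have "3 * (2 + ln (real M)) * \<beta> \<le> 3 * (3 * LL) * \<beta>"
    using lnM \<beta> by (intro mult_right_mono) auto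
  ultimately have "S * ln (1 / p) \<le> 2 / 3 * S * (17 + ln (1 / p)) + 9 * LL * \<beta> + 16 * S"
    using ent[OF M(3)] tail unfolding nS by simp
  then have "S * (ln (1 / p) / 3 - 28) \<le> 9 * LL * \<beta>" using Spos by (simp add: algebra_simps)
  moreover have "S * (ln (1 / p) / 6) \<le> S * (ln (1 / p) / 3 - 28)"
    using p(2) Spos by (intro mult_left_mono) auto
  ultimately have "S * (ln (1 / p) / 6) \<le> 9 * LL * \<beta>" by linarith
  moreover have "S * (log 2 (1 / p) / 12) \<le> S * (ln (1 / p) / 6)"
    using mult_right_mono[OF ln2(1), of "log 2 (1 / p)"] lp Spos l1 by (intro mult_left_mono) auto
  ultimately have "S * log 2 (1 / p) \<le> 108 * \<beta> * LL" by (simp add: algebra_simps)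
  then have "S * log 2 (1 / p) / LL \<le> 108 * \<beta>" using LL by (simp add: divide_le_eq)
  then show ?thesis by (simp add: LL_def L_def)
qed

theorem theorem1p3:
  shows "\<exists>c::real. c > 0 \<and>
    (\<forall>(n::nat) (A::(nat \<Rightarrow> nat) set) (p::real).
       A \<subseteq> Sym n \<longrightarrow> conjugation_invariant n A \<longrightarrow>
       0 < card A \<longrightarrow> real (card A) \<le> fact n / 2 \<longrightarrow>
       p = real (card A) / fact n \<longrightarrow>
       real (card (edge_boundary n A)) \<ge>
         c * (log 2 (1 / p) / log 2 (log 2 (2 / p))) * real n * real (card A))"
\<comment> \<open>2880 = 8 * 360 is what the case of bounded density requires; the entropy case
  needs only 432 = 4 * 108.\<close>
proof (intro exI[of _ "1 / 2880"] conjI allI impI)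
  fix n :: nat and A :: "(nat \<Rightarrow> nat) set" and p :: real
  assume A: "A \<subseteq> Sym n" "conjugation_invariant n A" and pos: "0 < card A"
    and half: "real (card A) \<le> fact n / 2" and p: "p = real (card A) / fact n"
  define R where "R = log 2 (1 / p) / log 2 (log 2 (2 / p))"
  let ?bd = "real (card (edge_boundary n A))"
  have half': "2 * card A \<le> fact n"
  proof -
    have "real (2 * card A) \<le> real (fact n)" using half by simp
    then show ?thesis by (simp only: of_nat_le_iff)
  qed
  have n: "n \<ge> 2"
  proof (rule ccontr)
    assume "\<not> n \<ge> 2"
    then have "n = 0 \<or> n = 1" by auto
    then show False using half' pos by auto
  qed
  have p0: "0 < p" "p \<le> 1 / 2" using pos half unfolding p by (simp_all add: field_simps)
  define B where "B = cycle_counts {1..n} 1 ` A"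
  define S where "S = (\<Sum>y\<in>B. weight n y)"
  define \<beta> where "\<beta> = (\<Sum>y\<in>rooted_types n. weight n y * real (card {j \<in> {1..<root_len n y}. (y \<in> B) \<noteq> (add_cycle j y \<in> B)}))"
  have one: "1 \<in> {1..n}" using n by simp
  have B: "B \<subseteq> rooted_types n" "B \<noteq> {}"
    using A(1) cycle_counts_rooted_types(1)[OF _ one] pos unfolding B_def by (auto simp: Sym_def)
  have AB: "A = {\<sigma>. \<sigma> permutes {1..n} \<and> cycle_counts {1..n} 1 \<sigma> \<in> B}"
    unfolding B_def using n by (intro cycle_counts_determines_membership A) simp
  have cA: "real (card A) = fact (n - 1) * S"
    using card_permutes_cycle_counts[OF _ one, of B] B(1) unfolding AB[symmetric] S_def by simp
  have fn: "fact n = real n * fact (n - 1)" using n by (intro fact_reduce) simp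
  have S: "S = real n * p" unfolding p cA fn using n by simp
  have "real (card {(\<sigma>, k). \<sigma> permutes {1..n} \<and> k \<in> {1..n} \<and> k \<notin> orbit \<sigma> 1 \<and> (\<sigma> \<in> A) \<noteq> (\<sigma> \<circ> transpose 1 k \<in> A)}) =
      fact (n - 1) * \<beta>"
    using card_merge_boundary[OF _ one, of B] unfolding AB[symmetric] \<beta>_def by simp
  then have bd: "real n * (fact (n - 1) * \<beta>) \<le> 4 * ?bd"
    using of_nat_mono[OF edge_boundary_bounds(2)[OF A n half'], where 'a=real] by simp
  have bd': "real n * real (card A) \<le> 8 * ?bd"
    using of_nat_mono[OF edge_boundary_bounds(1)[OF A n half'], where 'a=real] by simp
  have \<beta>: "\<beta> \<ge> 0" unfolding \<beta>_def using weight_pos by (intro sum_nonneg mult_nonneg_nonneg) (auto intro: less_imp_le)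
  have "1 / 2880 * R * real n * real (card A) \<le> ?bd"
  proof (cases "ln (1 / p) \<ge> 180")
    case True
    have "S * R \<le> 108 * \<beta>" unfolding R_def
    proof (rule small_sets_bound[OF _ p0(1) True S \<beta>])
      fix M :: nat assume M: "M \<ge> 3"
      show "S * ln (real n / S) \<le> 2 / 3 * S * ln (18 * real n / S) + 3 * (2 + ln (real M)) * \<beta> + 16 * real n / 2 ^ M"
        unfolding S_def \<beta>_def
        by (rule entropy_inequality[OF _ B M])
          (use n cycle_counts_image_symmetric[OF A] in \<open>auto simp: B_def\<close>)
    qed (use n in simp)
    then have "real n * fact (n - 1) * (S * R) \<le> real n * fact (n - 1) * (108 * \<beta>)"
      by (intro mult_left_mono) auto
    then have "real n * real (card A) * R \<le> 432 * ?bd"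
      using bd unfolding cA by (simp add: mult_ac)
    then show ?thesis by (simp add: mult_ac)
  next
    case False
    \<comment> \<open>As p \<le> 1/2, the inner logarithm is at least 2 and the denominator of
      \<open>R\<close> at least 1.\<close>
    have "log 2 (2 / p) \<ge> log 2 4" using p0 by (subst log_le_cancel_iff) (auto simp: field_simps)
    moreover have "log 2 (4::real) = 2" by (simp add: log_def ln_realpow[of 2 2, simplified])
    ultimately have "log 2 2 \<le> log 2 (log 2 (2 / p))" by (subst log_le_cancel_iff) auto
    then have LL: "1 \<le> log 2 (log 2 (2 / p))" by simp
    have "log 2 (1 / p) = ln (1 / p) / ln 2" by (simp add: log_def)
    also have "\<dots> \<le> 180 / ln 2" using False by (intro divide_right_mono) auto
    also have "\<dots> \<le> 180 / (1 / 2)" using ln_2_ge_half by (intro divide_left_mono) auto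
    finally have l: "log 2 (1 / p) \<le> 360" by simp
    have "0 \<le> log 2 (1 / p)" using p0 by simp
    then have "R \<le> log 2 (1 / p) / 1" unfolding R_def using LL by (intro divide_left_mono) auto
    then have "R \<le> 360" using l by simp
    then have "R * (real n * real (card A)) \<le> 360 * (real n * real (card A))"
      by (intro mult_right_mono) auto
    then show ?thesis using bd' by (simp add: mult_ac)
  qed
  then show "1 / 2880 * (log 2 (1 / p) / log 2 (log 2 (2 / p))) * real n * real (card A) \<le> ?bd"
    by (simp only: R_def)
qed simp

end
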